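(* For every nonzero real number $M\in(-\frac14,\infty)$, the Delaunay surface $\mathbb{D}(M)$ generated by the conic $\{(x,y):4x^2-\frac{y^2}{M}=1\}$ has constant mean curvature $1$. Moreover, the quotient between the maximum value of the Gauss curvature and the minimum value of the Gauss curvature of $\mathbb{D}(M)$ is $$rs(M)=-\left(\frac{1-\sqrt{1+4M}}{1+\sqrt{1+4M}}\right)^2 .$$
   Context: Delaunay surface generated by a conic: roll the conic, without slipping, on a line in a plane, and rotate about this line the trace of a focus. For $M<0$ the conic is an ellipse, the profile curve is the trace of one focus as the ellipse rolls along the whole line, and the surface of revolution $\mathbb{D}(M)$ is called an unduloid. For $M>0$ the conic is a hyperbola and both foci are used: as a branch of the hyperbola rolls on the line, the two foci trace two arcs (one on each side of the line); after reflecting one of them in the line and translating along the line, copies of these two arcs alternately fit together into a complete $C^2$ (in fact smooth) periodic curve, which is the profile curve rotated about the line to obtain $\mathbb{D}(M)$, called a nodoid. The mean curvature is half the sum of the principal curvatures, with respect to a suitable choice of unit normal. *)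

theory Defs
  imports "HOL-Analysis.Analysis"
begin

section \<open>Curvature of parametrized surfaces in three-space\<close>

text \<open>Nodoids intersect themselves, so surfaces are treated as parametrized (immersed) surfaces
  and curvatures are functions on the parameter plane.\<close>

type_synonym param_surface = "real \<times> real \<Rightarrow> real ^ 3"

definition partial_u :: "param_surface \<Rightarrow> param_surface" where
  "partial_u X p = vector_derivative (\<lambda>s. X (s, snd p)) (at (fst p))"

definition partial_v :: "param_surface \<Rightarrow> param_surface" where
  "partial_v X p = vector_derivative (\<lambda>s. X (fst p, s)) (at (snd p))"

definition unit_normal_field :: "param_surface \<Rightarrow> param_surface \<Rightarrow> bool" where
  "unit_normal_field X N \<longleftrightarrow> continuous_on UNIV N \<and>
     (\<forall>p. norm (N p) = 1 \<and> N p \<bullet> partial_u X p = 0 \<and> N p \<bullet> partial_v X p = 0)"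

text \<open>The fundamental forms, evaluated on the tangent vector with coordinates \<open>w\<close> in the
  basis of the two partial derivatives.\<close>

definition first_form :: "param_surface \<Rightarrow> real \<times> real \<Rightarrow> real \<times> real \<Rightarrow> real" where
  "first_form X p w = (norm (fst w *\<^sub>R partial_u X p + snd w *\<^sub>R partial_v X p))\<^sup>2"

definition second_form ::
    "param_surface \<Rightarrow> param_surface \<Rightarrow> real \<times> real \<Rightarrow> real \<times> real \<Rightarrow> real" where
  "second_form X N p w =
     N p \<bullet> ((fst w)\<^sup>2 *\<^sub>R partial_u (partial_u X) p
            + (2 * fst w * snd w) *\<^sub>R partial_v (partial_u X) p
            + (snd w)\<^sup>2 *\<^sub>R partial_v (partial_v X) p)"

definition normal_curvature ::
    "param_surface \<Rightarrow> param_surface \<Rightarrow> real \<times> real \<Rightarrow> real \<times> real \<Rightarrow> real" where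
  "normal_curvature X N p w = second_form X N p w / first_form X p w"

text \<open>The principal curvatures are the largest and the smallest normal curvature.\<close>

definition max_principal_curvature :: "param_surface \<Rightarrow> param_surface \<Rightarrow> real \<times> real \<Rightarrow> real" where
  "max_principal_curvature X N p = (SUP w \<in> - {0}. normal_curvature X N p w)"

definition min_principal_curvature :: "param_surface \<Rightarrow> param_surface \<Rightarrow> real \<times> real \<Rightarrow> real" where
  "min_principal_curvature X N p = (INF w \<in> - {0}. normal_curvature X N p w)"

definition mean_curvature :: "param_surface \<Rightarrow> param_surface \<Rightarrow> real \<times> real \<Rightarrow> real" where
  "mean_curvature X N p = (max_principal_curvature X N p + min_principal_curvature X N p) / 2"

definition gauss_curvature :: "param_surface \<Rightarrow> param_surface \<Rightarrow> real \<times> real \<Rightarrow> real" where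
  "gauss_curvature X N p = max_principal_curvature X N p * min_principal_curvature X N p"

text \<open>The surface obtained by rotating a plane curve about the real axis.\<close>

definition surface_of_revolution :: "(real \<Rightarrow> complex) \<Rightarrow> param_surface" where
  "surface_of_revolution \<delta> p =
     vector [Re (\<delta> (fst p)), Im (\<delta> (fst p)) * cos (snd p), Im (\<delta> (fst p)) * sin (snd p)]"


section \<open>Rolling a curve on the real axis\<close>

definition arc_length :: "(real \<Rightarrow> complex) \<Rightarrow> real \<Rightarrow> real" where
  "arc_length \<gamma> t = (LBINT \<tau>=0..t. norm (vector_derivative \<gamma> (at \<tau>)))"

text \<open>The orientation-preserving rigid motion of the plane that carries the curve into its position
  at time \<open>t\<close>: the point \<open>\<gamma> t\<close> is put on the real axis, the unit tangent
  at that point is turned into \<open>1\<close>, and, as there is no slipping, the abscissa of the point of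
  contact is the (signed) length of the part of the curve that has been in contact.\<close>

definition rolling_motion :: "(real \<Rightarrow> complex) \<Rightarrow> real \<Rightarrow> complex \<Rightarrow> complex" where
  "rolling_motion \<gamma> t z =
     of_real (arc_length \<gamma> t) + (z - \<gamma> t) / sgn (vector_derivative \<gamma> (at t))"

definition rolling_trace :: "(real \<Rightarrow> complex) \<Rightarrow> complex \<Rightarrow> real \<Rightarrow> complex" where
  "rolling_trace \<gamma> F t = rolling_motion \<gamma> t F"

lemma rolling_motion_contact: "rolling_motion \<gamma> t (\<gamma> t) = of_real (arc_length \<gamma> t)"
  by (simp add: rolling_motion_def)

lemma rolling_motion_isometry:
  assumes "vector_derivative \<gamma> (at t) \<noteq> 0"
  shows "dist (rolling_motion \<gamma> t z) (rolling_motion \<gamma> t w) = dist z w"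
  using assms
  by (simp add: rolling_motion_def dist_norm norm_divide norm_sgn flip: diff_divide_distrib)


section \<open>The conics\<close>

definition conic :: "real \<Rightarrow> complex set" where
  "conic M = {z. 4 * (Re z)\<^sup>2 - (Im z)\<^sup>2 / M = 1}"

definition conic_foci :: "real \<Rightarrow> complex set" where
  "conic_foci M = {of_real (sqrt (1/4 + M)), - of_real (sqrt (1/4 + M))}"

definition ellipse_param :: "real \<Rightarrow> real \<Rightarrow> complex" where
  "ellipse_param M t = Complex (cos t / 2) (sqrt (- M) * sin t)"

definition hyperbola_param :: "real \<Rightarrow> real \<Rightarrow> complex" where
  "hyperbola_param M t = Complex (cosh t / 2) (sqrt M * sinh t)"

lemma range_ellipse_param:
  assumes "M < 0"
  shows "range (ellipse_param M) = conic M"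
proof (intro set_eqI iffI)
  fix z assume "z \<in> range (ellipse_param M)"
  then show "z \<in> conic M"
    using assms by (auto simp: conic_def ellipse_param_def power_mult_distrib power_divide)
next
  fix z assume "z \<in> conic M"
  then have "(2 * Re z)\<^sup>2 + (Im z / sqrt (- M))\<^sup>2 = 1"
    using assms by (simp add: conic_def power_mult_distrib power_divide)
  then obtain t where "2 * Re z = cos t" "Im z / sqrt (- M) = sin t"
    by (metis sincos_total_2pi)
  then have "z = ellipse_param M t"
    using assms by (auto simp: ellipse_param_def complex_eq_iff field_simps)
  then show "z \<in> range (ellipse_param M)" by blast
qed

lemma range_hyperbola_param:
  assumes "M > 0"
  shows "range (hyperbola_param M) = {z \<in> conic M. Re z > 0}"
proof (intro set_eqI iffI)
  fix z assume "z \<in> range (hyperbola_param M)"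
  then show "z \<in> {z \<in> conic M. Re z > 0}"
    using assms
    by (auto simp: conic_def hyperbola_param_def power_mult_distrib power_divide cosh_square_eq field_simps)
next
  fix z assume z: "z \<in> {z \<in> conic M. Re z > 0}"
  define t where "t = arsinh (Im z / sqrt M)"
  have s: "sinh t = Im z / sqrt M" by (simp add: t_def)
  have "(cosh t)\<^sup>2 = (2 * Re z)\<^sup>2"
    using z assms by (simp add: cosh_square_eq s conic_def power_mult_distrib power_divide)
  then have "cosh t = 2 * Re z"
    by (rule power2_eq_imp_eq) (use z in auto)
  then have "z = hyperbola_param M t"
    using assms s by (auto simp: hyperbola_param_def complex_eq_iff field_simps)
  then show "z \<in> range (hyperbola_param M)" by blast
qed

lemma conic_focal_distances:
  assumes "M \<noteq> 0" "-1/4 < M" "z \<in> conic M" and c: "c = sqrt (1/4 + M)"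
  shows "dist z (of_real c) = \<bar>2 * c * Re z - 1/2\<bar>"
    and "dist z (- of_real c) = \<bar>2 * c * Re z + 1/2\<bar>"
proof -
  have c2: "c\<^sup>2 = 1/4 + M" using assms by simp
  have y2: "(Im z)\<^sup>2 = M * (4 * (Re z)\<^sup>2 - 1)"
    using assms by (simp add: conic_def field_simps)
  have "(Re z - c)\<^sup>2 + (Im z)\<^sup>2 = (2 * c * Re z - 1/2)\<^sup>2"
    "(Re z + c)\<^sup>2 + (Im z)\<^sup>2 = (2 * c * Re z + 1/2)\<^sup>2"
    unfolding y2 using c2 by algebra+
  then show "dist z (of_real c) = \<bar>2 * c * Re z - 1/2\<bar>"
    "dist z (- of_real c) = \<bar>2 * c * Re z + 1/2\<bar>"
    by (simp_all add: dist_norm cmod_def)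
qed

lemma ellipse_focal_property:
  assumes "M < 0" "-1/4 < M" "z \<in> conic M" and c: "c = sqrt (1/4 + M)"
  shows "dist z (of_real c) + dist z (- of_real c) = 1"
proof -
  have "(Im z)\<^sup>2 / M \<le> 0"
    using assms by (simp add: divide_le_0_iff)
  then have "4 * (Re z)\<^sup>2 \<le> 1"
    using assms by (simp add: conic_def)
  then have "(2 * Re z)\<^sup>2 \<le> 1\<^sup>2" by (simp add: power_mult_distrib)
  then have x: "\<bar>2 * Re z\<bar> \<le> 1"
    by (metis abs_le_square_iff abs_one)
  have "c\<^sup>2 < (1/2)\<^sup>2" using assms by (simp add: power2_eq_square)
  then have "c < 1/2" by (rule power2_less_imp_less) simp
  moreover have "c \<ge> 0" using assms by simp
  ultimately have "\<bar>c * (2 * Re z)\<bar> \<le> 1/2 * 1"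
    unfolding abs_mult using x by (intro mult_mono) auto
  then show ?thesis
    using conic_focal_distances[OF _ assms(2,3) c] assms(1) by (auto simp: mult.assoc mult.left_commute)
qed

lemma hyperbola_focal_property:
  assumes "0 < M" "z \<in> conic M" and c: "c = sqrt (1/4 + M)"
  shows "\<bar>dist z (of_real c) - dist z (- of_real c)\<bar> = 1"
proof -
  have "4 * (Re z)\<^sup>2 = 1 + (Im z)\<^sup>2 / M" using assms by (simp add: conic_def)
  then have "(2 * Re z)\<^sup>2 \<ge> 1\<^sup>2" using assms by (simp add: power_mult_distrib)
  then have x: "\<bar>2 * Re z\<bar> \<ge> 1" by (metis abs_le_square_iff abs_one)
  have "c > 1/2" unfolding c using assms by (intro real_less_rsqrt) (simp add: power2_eq_square)
  then have "1/2 * 1 \<le> \<bar>c * (2 * Re z)\<bar>"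
    unfolding abs_mult using x by (intro mult_mono) auto
  then show ?thesis
    using conic_focal_distances[OF _ _ assms(2) c] assms(1)
    by (auto simp: mult.assoc mult.left_commute)
qed


section \<open>Delaunay surfaces\<close>

definition C2_on :: "real set \<Rightarrow> (real \<Rightarrow> 'a::real_normed_vector) \<Rightarrow> bool" where
  "C2_on S f \<longleftrightarrow> (\<exists>f' f''. (\<forall>t\<in>S. (f has_vector_derivative f' t) (at t)) \<and>
                         (\<forall>t\<in>S. (f' has_vector_derivative f'' t) (at t)) \<and>
                         continuous_on S f'')"

definition C2_regular_curve :: "(real \<Rightarrow> complex) \<Rightarrow> bool" where
  "C2_regular_curve \<delta> \<longleftrightarrow> C2_on UNIV \<delta> \<and> (\<forall>t. vector_derivative \<delta> (at t) \<noteq> 0)"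

text \<open>On the open interval \<open>S\<close> the curve \<open>\<delta>\<close> runs once through the whole of \<open>\<alpha>\<close> (which is
  parametrized by the real line), up to an orientation-preserving change of parameter.\<close>

definition traverses :: "(real \<Rightarrow> complex) \<Rightarrow> real set \<Rightarrow> (real \<Rightarrow> complex) \<Rightarrow> bool" where
  "traverses \<delta> S \<alpha> \<longleftrightarrow> (\<exists>\<phi>. C2_on S \<phi> \<and> (\<forall>t\<in>S. deriv \<phi> t > 0) \<and> \<phi> ` S = UNIV \<and>
                             (\<forall>t\<in>S. \<delta> t = \<alpha> (\<phi> t)))"

definition unduloid_profile :: "real \<Rightarrow> (real \<Rightarrow> complex) \<Rightarrow> bool" where
  "unduloid_profile M \<delta> \<longleftrightarrow> C2_regular_curve \<delta> \<and>
     (\<exists>F \<in> conic_foci M. traverses \<delta> UNIV (rolling_trace (ellipse_param M) F))"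

text \<open>The right branch, run through upwards, has the focus inside it on its right and the other
  focus on its left. Hence the first one is traced below the axis and the second one above it, and
  the first trace is the one to be reflected.\<close>

definition nodoid_arc :: "real \<Rightarrow> int \<Rightarrow> real \<Rightarrow> complex" where
  "nodoid_arc M k t =
     (if even k then cnj (rolling_trace (hyperbola_param M) (of_real (sqrt (1/4 + M))) t)
      else rolling_trace (hyperbola_param M) (- of_real (sqrt (1/4 + M))) t)"

text \<open>The numbers \<open>u k\<close> are the parameters of the junctions and \<open>\<tau> k\<close> are the
  translations along the axis; the latter are determined, up to a common summand, by the
  continuity of \<open>\<delta>\<close>. The arcs are open: their end points, which correspond to the points
  at infinity of the branch, are the values of \<open>\<delta>\<close> at the junctions.\<close>

definition nodoid_profile :: "real \<Rightarrow> (real \<Rightarrow> complex) \<Rightarrow> bool" where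
  "nodoid_profile M \<delta> \<longleftrightarrow> C2_regular_curve \<delta> \<and>
     (\<exists>(u :: int \<Rightarrow> real) (\<tau> :: int \<Rightarrow> real).
        strict_mono u \<and> (\<forall>x. \<exists>k. u k \<le> x \<and> x < u (k + 1)) \<and>
        (\<forall>k. traverses \<delta> {u k<..<u (k + 1)} (\<lambda>t. nodoid_arc M k t + of_real (\<tau> k))))"

definition delaunay_profile :: "real \<Rightarrow> (real \<Rightarrow> complex) \<Rightarrow> bool" where
  "delaunay_profile M \<delta> \<longleftrightarrow> (if M < 0 then unduloid_profile M \<delta> else nodoid_profile M \<delta>)"

text \<open>The surface is determined by \<open>M\<close> up to a change of parameters and a motion of space (the
  choice of a focus of the ellipse, a translation along the axis).\<close>

definition delaunay_surface :: "real \<Rightarrow> param_surface \<Rightarrow> bool" where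
  "delaunay_surface M X \<longleftrightarrow> (\<exists>\<delta>. delaunay_profile M \<delta> \<and> X = surface_of_revolution \<delta>)"

end

theory Submission
  imports Defs
begin

text \<open>When a curve rolls on a line, the point of contact is the instantaneous centre of rotation,
  so the segment from it to the traced point is normal to the trace. For a focus of a conic the
  length \<open>r\<close> of this segment and the height \<open>y\<close> of the focus are tied together: both focal radii make
  the same angle with the tangent, the product of the distances of the foci from the tangent is
  \<open>\<bar>M\<bar>\<close>, and the sum or difference of the focal radii is 1. Eliminating the second focus gives the
  first integral \<open>y\<^sup>2 - \<eta> * y * cos \<alpha> = M\<close>, where \<open>\<alpha>\<close> is the angle between the trace and the axis
  and \<open>\<eta>\<close> is 1 for the ellipse and \<open>-1\<close> for the hyperbola (\<open>delaunay_equation\<close>). The lemmas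
  \<open>rolling_trace_ellipse\<close> and \<open>rolling_trace_hyperbola\<close> obtain the height and the velocity of the
  trace by computation, and the first integral is read off in \<open>focal_arc_ellipse\<close> and
  \<open>focal_arc_hyperbola\<close>.

  Everything else follows from the first integral. Up to the sign of the normal, the principal
  curvature along the parallels is \<open>cos \<alpha> / y\<close>, which equals \<open>1 - M / y\<^sup>2\<close> for the right sign, and
  differentiating the first integral shows that the two principal curvatures have sum 2
  (\<open>delaunay_equation_imp_curvature_sum\<close>). So the mean curvature is 1 and the Gauss curvature is
  \<open>1 - (M / y\<^sup>2)\<^sup>2\<close>. It is extremal where \<open>y\<close> is, that is, where the tangent is parallel to the axis;
  there \<open>y = \<bar>c \<plusminus> 1/2\<bar>\<close> with \<open>c = sqrt (1/4 + M)\<close>, and the quotient of the two extremal values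
  is the asserted one (\<open>delaunay_equation_imp_curvature_ratio\<close>).

  Since the surface is given only through the arcs of its profile, the first integral is carried
  over by the change of parameter (\<open>traverses_focal_arc\<close>) and, for the nodoid, extended to the
  junctions by continuity (\<open>delaunay_equation_extends\<close>). Existence is immediate for the unduloid,
  whose profile is the trace itself. For the nodoid, the first integral is solved explicitly with
  the tangent angle as parameter, and the solution is recognized as a chain of focal arcs
  (\<open>nodoid_profile_exists\<close>).\<close>

section \<open>Surfaces of revolution\<close>

lemma has_vector_derivative_vector_3:
  assumes "(f has_real_derivative f') (at t)" "(g has_real_derivative g') (at t)"
    "(h has_real_derivative h') (at t)"
  shows "((\<lambda>s. vector [f s, g s, h s] :: real ^ 3) has_vector_derivative vector [f', g', h']) (at t)"
proof -
  have split: "vector [a, b, c] = a *\<^sub>R axis 1 1 + b *\<^sub>R axis 2 1 + c *\<^sub>R (axis 3 1 :: real ^ 3)"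
    for a b c :: real
    by (simp add: vec_eq_iff forall_3 axis_def)
  show ?thesis
    unfolding split using assms
    by (auto intro!: derivative_eq_intros)
qed

lemma inner_vector_3: "(vector [a, b, c] :: real ^ 3) \<bullet> vector [a', b', c'] = a * a' + b * b' + c * c'"
  by (simp add: inner_vec_def sum_3)

lemma scaleR_vector_3: "r *\<^sub>R (vector [a, b, c] :: real ^ 3) = vector [r * a, r * b, r * c]"
  by (simp add: vec_eq_iff forall_3)

lemma add_vector_3: "(vector [a, b, c] :: real ^ 3) + vector [a', b', c'] = vector [a + a', b + b', c + c']"
  by (simp add: vec_eq_iff forall_3)

lemmas vector_3_arith = inner_vector_3 scaleR_vector_3 add_vector_3

lemma continuous_on_vector_3:
  assumes "continuous_on S f" "continuous_on S g" "continuous_on S h"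
  shows "continuous_on S (\<lambda>p. vector [f p, g p, h p] :: real ^ 3)"
proof -
  have split: "vector [a, b, c] = a *\<^sub>R axis 1 1 + b *\<^sub>R axis 2 1 + c *\<^sub>R (axis 3 1 :: real ^ 3)"
    for a b c :: real
    by (simp add: vec_eq_iff forall_3 axis_def)
  show ?thesis
    unfolding split using assms by (intro continuous_intros)
qed

text \<open>In an orthogonal basis that diagonalizes both fundamental forms the normal curvature is a
  weighted mean of the two curvatures along the basis vectors, with weights that can be
  concentrated on either of them; its extreme values are therefore these two curvatures.\<close>

lemma weighted_mean_bounds:
  fixes k1 k2 A B :: real
  assumes "A > 0" "B > 0"
  defines "Q \<equiv> \<lambda>w::real \<times> real.
     (k1 * (A * (fst w)\<^sup>2) + k2 * (B * (snd w)\<^sup>2)) / (A * (fst w)\<^sup>2 + B * (snd w)\<^sup>2)"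
  shows "(SUP w \<in> - {0}. Q w) = max k1 k2" "(INF w \<in> - {0}. Q w) = min k1 k2"
proof -
  have Q: "Q (1, 0) = k1" "Q (0, 1) = k2"
    using assms by (simp_all add: Q_def)
  have pos: "A * (fst w)\<^sup>2 + B * (snd w)\<^sup>2 > 0" if "w \<noteq> 0" for w :: "real \<times> real"
  proof (cases "fst w = 0")
    case True
    then have "snd w \<noteq> 0" using that by (auto simp: prod_eq_iff)
    with True assms show ?thesis by simp
  next
    case False
    with assms show ?thesis by (intro add_pos_nonneg) auto
  qed
  have le: "Q w \<le> max k1 k2" and ge: "min k1 k2 \<le> Q w" if "w \<noteq> 0" for w
  proof -
    have "k1 * (A * (fst w)\<^sup>2) \<le> max k1 k2 * (A * (fst w)\<^sup>2)"
      "k2 * (B * (snd w)\<^sup>2) \<le> max k1 k2 * (B * (snd w)\<^sup>2)"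
      "min k1 k2 * (A * (fst w)\<^sup>2) \<le> k1 * (A * (fst w)\<^sup>2)"
      "min k1 k2 * (B * (snd w)\<^sup>2) \<le> k2 * (B * (snd w)\<^sup>2)"
      using assms by (auto intro!: mult_right_mono)
    then show "Q w \<le> max k1 k2" "min k1 k2 \<le> Q w"
      using pos[OF that] by (simp_all add: Q_def divide_le_eq le_divide_eq distrib_left)
  qed
  have "w0 \<noteq> 0 \<Longrightarrow> Q w0 = max k1 k2 \<Longrightarrow> (SUP w \<in> - {0}. Q w) = max k1 k2"
    "w0 \<noteq> 0 \<Longrightarrow> Q w0 = min k1 k2 \<Longrightarrow> (INF w \<in> - {0}. Q w) = min k1 k2" for w0
    using le ge by (auto intro!: cSup_eq_maximum cInf_eq_minimum image_eqI[of _ Q w0])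
  from this[of "(1, 0)"] this[of "(0, 1)"] Q
  show "(SUP w \<in> - {0}. Q w) = max k1 k2" "(INF w \<in> - {0}. Q w) = min k1 k2"
    by (auto simp: max_def min_def zero_prod_def)
qed

text \<open>The directions of the meridians and parallels diagonalize both fundamental forms. The principal
  curvatures are therefore \<open>k1\<close>, the signed curvature of the profile, and \<open>k2\<close>, the curvature of
  the parallel circle multiplied by the cosine of the angle between its plane and the normal
  (Meusnier). The sign \<open>\<eta>\<close> selects one of the two unit normals.\<close>

lemma curvatures_surface_of_revolution:
  fixes \<delta> \<delta>' \<delta>'' :: "real \<Rightarrow> complex" and \<eta> :: real
  assumes d1: "\<And>t. (\<delta> has_vector_derivative \<delta>' t) (at t)"
    and d2: "\<And>t. (\<delta>' has_vector_derivative \<delta>'' t) (at t)"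
    and reg: "\<And>t. \<delta>' t \<noteq> 0" and pos: "\<And>t. Im (\<delta> t) > 0" and eta: "\<bar>\<eta>\<bar> = 1"
  defines "X \<equiv> surface_of_revolution \<delta>"
    and "k1 \<equiv> \<lambda>t. \<eta> * (Im (\<delta>' t) * Re (\<delta>'' t) - Re (\<delta>' t) * Im (\<delta>'' t)) / norm (\<delta>' t) ^ 3"
    and "k2 \<equiv> \<lambda>t. \<eta> * Re (\<delta>' t) / (norm (\<delta>' t) * Im (\<delta> t))"
    and "N \<equiv> \<lambda>p. (\<eta> / norm (\<delta>' (fst p))) *\<^sub>R
       vector [Im (\<delta>' (fst p)), - Re (\<delta>' (fst p)) * cos (snd p), - Re (\<delta>' (fst p)) * sin (snd p)]"
  shows "unit_normal_field X N"
    and "mean_curvature X N p = (k1 (fst p) + k2 (fst p)) / 2"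
    and "gauss_curvature X N p = k1 (fst p) * k2 (fst p)"
proof -
  have Xu: "partial_u X =
      (\<lambda>p. vector [Re (\<delta>' (fst p)), Im (\<delta>' (fst p)) * cos (snd p), Im (\<delta>' (fst p)) * sin (snd p)])"
    unfolding partial_u_def X_def surface_of_revolution_def
    by (rule ext, rule vector_derivative_at, simp, rule has_vector_derivative_vector_3)
      (auto intro!: derivative_eq_intros d1)
  have Xv: "partial_v X =
      (\<lambda>p. vector [0, - Im (\<delta> (fst p)) * sin (snd p), Im (\<delta> (fst p)) * cos (snd p)])"
    unfolding partial_v_def X_def surface_of_revolution_def
    by (rule ext, rule vector_derivative_at, simp, rule has_vector_derivative_vector_3)
      (auto intro!: derivative_eq_intros)
  have Xuu: "partial_u (partial_u X) =
      (\<lambda>p. vector [Re (\<delta>'' (fst p)), Im (\<delta>'' (fst p)) * cos (snd p), Im (\<delta>'' (fst p)) * sin (snd p)])"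
    unfolding Xu unfolding partial_u_def
    by (rule ext, rule vector_derivative_at, simp, rule has_vector_derivative_vector_3)
      (auto intro!: derivative_eq_intros d2)
  have Xuv: "partial_v (partial_u X) =
      (\<lambda>p. vector [0, - Im (\<delta>' (fst p)) * sin (snd p), Im (\<delta>' (fst p)) * cos (snd p)])"
    unfolding Xu unfolding partial_v_def
    by (rule ext, rule vector_derivative_at, simp, rule has_vector_derivative_vector_3)
      (auto intro!: derivative_eq_intros)
  have Xvv: "partial_v (partial_v X) =
      (\<lambda>p. vector [0, - Im (\<delta> (fst p)) * cos (snd p), - Im (\<delta> (fst p)) * sin (snd p)])"
    unfolding Xv unfolding partial_v_def
    by (rule ext, rule vector_derivative_at, simp, rule has_vector_derivative_vector_3)
      (auto intro!: derivative_eq_intros)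
  \<comment> \<open>The inner products below are polynomial identities modulo this relation.\<close>
  have trig: "(cos t)\<^sup>2 = 1 - (sin t)\<^sup>2" for t :: real by (simp add: cos_squared_eq)
  have norm2: "(norm (\<delta>' t))\<^sup>2 = (Re (\<delta>' t))\<^sup>2 + (Im (\<delta>' t))\<^sup>2" for t by (simp add: cmod_power2)
  have eta2: "\<eta>\<^sup>2 = 1" using eta by (metis power2_abs one_power2)
  have cont: "continuous_on UNIV \<delta>'"
    using d2 by (meson has_vector_derivative_continuous continuous_at_imp_continuous_on)
  have contp: "continuous_on UNIV (\<lambda>p::real \<times> real. \<delta>' (fst p))"
    by (rule continuous_on_compose2[OF cont]) (auto intro!: continuous_intros)
  show "unit_normal_field X N"
    unfolding unit_normal_field_def
  proof (intro conjI allI)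
    show "continuous_on UNIV N"
      unfolding N_def using reg
      by (intro continuous_intros continuous_on_vector_3 contp) auto
    fix p :: "real \<times> real"
    define s where "s = norm (\<delta>' (fst p))"
    have s: "s > 0" "s\<^sup>2 = (Re (\<delta>' (fst p)))\<^sup>2 + (Im (\<delta>' (fst p)))\<^sup>2"
      using reg norm2 by (auto simp: s_def)
    have "N p \<bullet> N p = (\<eta> / s)\<^sup>2 * ((Re (\<delta>' (fst p)))\<^sup>2 + (Im (\<delta>' (fst p)))\<^sup>2)"
      unfolding N_def s_def[symmetric] vector_3_arith using trig[of "snd p"] by algebra
    also have "\<dots> = 1"
      unfolding s(2)[symmetric] using s(1) eta2 by (simp add: power_divide)
    finally show "norm (N p) = 1" by (simp add: norm_eq_1)
    show "N p \<bullet> partial_u X p = 0"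
      unfolding N_def Xu s_def[symmetric] vector_3_arith using trig[of "snd p"] by algebra
    show "N p \<bullet> partial_v X p = 0"
      unfolding N_def Xv s_def[symmetric] vector_3_arith by algebra
  qed
  have nc: "normal_curvature X N p w =
      (k1 (fst p) * ((norm (\<delta>' (fst p)))\<^sup>2 * (fst w)\<^sup>2) + k2 (fst p) * ((Im (\<delta> (fst p)))\<^sup>2 * (snd w)\<^sup>2)) /
      ((norm (\<delta>' (fst p)))\<^sup>2 * (fst w)\<^sup>2 + (Im (\<delta> (fst p)))\<^sup>2 * (snd w)\<^sup>2)" for p w
  proof -
    define s where "s = norm (\<delta>' (fst p))"
    have s: "s > 0" "s\<^sup>2 = (Re (\<delta>' (fst p)))\<^sup>2 + (Im (\<delta>' (fst p)))\<^sup>2"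
      using reg norm2 by (auto simp: s_def)
    define y where "y = Im (\<delta> (fst p))"
    have y: "y > 0" using pos by (simp add: y_def)
    have "first_form X p w = s\<^sup>2 * (fst w)\<^sup>2 + y\<^sup>2 * (snd w)\<^sup>2"
      unfolding first_form_def power2_norm_eq_inner Xu Xv vector_3_arith y_def[symmetric] s(2)
      using trig[of "snd p"] by algebra
    moreover have "second_form X N p w =
        \<eta> / s * (Im (\<delta>' (fst p)) * Re (\<delta>'' (fst p)) - Re (\<delta>' (fst p)) * Im (\<delta>'' (fst p))) * (fst w)\<^sup>2
        + \<eta> / s * Re (\<delta>' (fst p)) * y * (snd w)\<^sup>2"
      unfolding second_form_def N_def Xuu Xuv Xvv vector_3_arith y_def[symmetric] s_def[symmetric]
      using trig[of "snd p"] by algebra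
    moreover have "k1 (fst p) * s\<^sup>2 =
        \<eta> / s * (Im (\<delta>' (fst p)) * Re (\<delta>'' (fst p)) - Re (\<delta>' (fst p)) * Im (\<delta>'' (fst p)))"
      "k2 (fst p) * y\<^sup>2 = \<eta> / s * Re (\<delta>' (fst p)) * y"
      using s(1) y by (simp_all add: k1_def k2_def s_def[symmetric] y_def[symmetric] 
          power2_eq_square power3_eq_cube)
    ultimately show ?thesis
      unfolding normal_curvature_def s_def y_def by (simp flip: mult.assoc)
  qed
  have "max_principal_curvature X N p = max (k1 (fst p)) (k2 (fst p))"
    "min_principal_curvature X N p = min (k1 (fst p)) (k2 (fst p))"
    unfolding max_principal_curvature_def min_principal_curvature_def nc
    using reg pos[of "fst p"] by (auto intro!: weighted_mean_bounds)
  then show "mean_curvature X N p = (k1 (fst p) + k2 (fst p)) / 2"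
    "gauss_curvature X N p = k1 (fst p) * k2 (fst p)"
    by (auto simp: mean_curvature_def gauss_curvature_def max_def min_def)
qed

section \<open>The first integral\<close>

text \<open>With \<open>y\<close> the distance \<open>Im z\<close> from the axis and \<open>\<alpha>\<close> the angle between the velocity \<open>p\<close> and the
  axis this is \<open>y\<^sup>2 - \<eta> * y * cos \<alpha> = M\<close>, the conservation law of surfaces of revolution with
  constant mean curvature. Multiplying by the speed makes it a condition that is closed and
  invariant under regular changes of parameter.\<close>

definition delaunay_equation :: "real \<Rightarrow> real \<Rightarrow> complex \<Rightarrow> complex \<Rightarrow> bool" where
  "delaunay_equation M \<eta> z p \<longleftrightarrow> ((Im z)\<^sup>2 - M) * norm p = \<eta> * Im z * Re p"

text \<open>Up to a nonvanishing factor, the derivative of the first integral is \<open>y'\<close> times the deviation of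
  the mean curvature from 1.
  The factor \<open>y'\<close> vanishes identically on a circular cylinder, which satisfies the first integral
  with a different mean curvature; hence the assumption that \<open>y'\<close> is nonzero on a dense set, from
  which the identity extends by continuity of the curvatures.\<close>

lemma delaunay_equation_imp_curvature_sum:
  fixes \<delta> \<delta>' \<delta>'' :: "real \<Rightarrow> complex" and \<eta> :: real
  assumes d1: "\<And>t. (\<delta> has_vector_derivative \<delta>' t) (at t)"
    and d2: "\<And>t. (\<delta>' has_vector_derivative \<delta>'' t) (at t)"
    and c2: "continuous_on UNIV \<delta>''"
    and reg: "\<And>t. \<delta>' t \<noteq> 0" and pos: "\<And>t. Im (\<delta> t) > 0"
    and eqn: "\<And>t. delaunay_equation M \<eta> (\<delta> t) (\<delta>' t)"
    and dense: "\<And>a b. a < b \<Longrightarrow> \<exists>t\<in>{a<..<b}. Im (\<delta>' t) \<noteq> 0"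
  defines "k1 \<equiv> \<lambda>t. \<eta> * (Im (\<delta>' t) * Re (\<delta>'' t) - Re (\<delta>' t) * Im (\<delta>'' t)) / norm (\<delta>' t) ^ 3"
    and "k2 \<equiv> \<lambda>t. \<eta> * Re (\<delta>' t) / (norm (\<delta>' t) * Im (\<delta> t))"
  shows "k1 t + k2 t = 2"
proof -
  have nonstationary: "k1 t + k2 t = 2" if "Im (\<delta>' t) \<noteq> 0" for t
  proof -
    define x' y' x'' y'' y s where "x' = Re (\<delta>' t)" "y' = Im (\<delta>' t)" "x'' = Re (\<delta>'' t)"
      "y'' = Im (\<delta>'' t)" "y = Im (\<delta> t)" "s = norm (\<delta>' t)"
    note defs = this
    have s: "s > 0" "s\<^sup>2 = x'\<^sup>2 + y'\<^sup>2"
      using reg by (simp_all add: defs cmod_power2)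
    have y: "y > 0" and y': "y' \<noteq> 0" using pos that by (simp_all add: defs)
    define s' where "s' = (x' * x'' + y' * y'') / s"
    have sq: "((\<lambda>t. (Re (\<delta>' t))\<^sup>2 + (Im (\<delta>' t))\<^sup>2) has_real_derivative 2 * (x' * x'' + y' * y'')) (at t)"
      by (auto intro!: derivative_eq_intros d2 simp: defs)
    have "(Re (\<delta>' t))\<^sup>2 + (Im (\<delta>' t))\<^sup>2 > 0"
      using zero_less_power[OF s(1), of 2] s(2) unfolding defs(1,2) by (simp only:)
    from DERIV_chain2[OF DERIV_real_sqrt[OF this] sq]
    have "((\<lambda>t. norm (\<delta>' t)) has_real_derivative
        inverse (norm (\<delta>' t)) / 2 * (2 * (x' * x'' + y' * y''))) (at t)"
      unfolding cmod_def .
    then have ds: "((\<lambda>t. norm (\<delta>' t)) has_real_derivative s') (at t)"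
      unfolding s'_def defs(6) by (rule DERIV_cong) (simp only: divide_inverse, simp)
    have "((\<lambda>t. ((Im (\<delta> t))\<^sup>2 - M) * norm (\<delta>' t) - \<eta> * Im (\<delta> t) * Re (\<delta>' t))
        has_real_derivative
        2 * y * y' * s + (y\<^sup>2 - M) * s' - \<eta> * (y' * x' + y * x'')) (at t)"
      by (auto intro!: derivative_eq_intros d1 d2 ds simp: defs algebra_simps)
    moreover have "(\<lambda>t. ((Im (\<delta> t))\<^sup>2 - M) * norm (\<delta>' t) - \<eta> * Im (\<delta> t) * Re (\<delta>' t)) = (\<lambda>_. 0)"
      using eqn by (simp add: delaunay_equation_def fun_eq_iff)
    ultimately have diff:
      "2 * y * y' * s + (y\<^sup>2 - M) * s' - \<eta> * (y' * x' + y * x'') = 0"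
      by (simp only:) (rule DERIV_unique[OF _ DERIV_const])
    have "(y\<^sup>2 - M) * s = \<eta> * y * x'"
      using eqn[of t] by (simp add: delaunay_equation_def defs)
    moreover have "s * s' = x' * x'' + y' * y''"
      using s(1) by (simp add: s'_def)
    \<comment> \<open>Multiplying the derivative by the square of the speed removes all denominators, and the
      factor \<open>y'\<close> splits off.\<close>
    ultimately have "y' * (2 * y * s ^ 3) = y' * (\<eta> * (y * (y' * x'' - x' * y'') + x' * s\<^sup>2))"
      using diff s(2) by algebra
    then have "2 * y * s ^ 3 = \<eta> * (y * (y' * x'' - x' * y'') + x' * s\<^sup>2)"
      using y' by simp
    moreover have "k1 t + k2 t = \<eta> * (y * (y' * x'' - x' * y'') + x' * s\<^sup>2) / (y * s ^ 3)"
      using s(1) y unfolding k1_def k2_def defs[symmetric]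
      by (simp add: field_simps power2_eq_square power3_eq_cube)
    moreover have "2 * y * s ^ 3 / (y * s ^ 3) = 2"
      using s(1) y by simp
    ultimately show ?thesis by simp
  qed
  have c: "continuous_on UNIV \<delta>" "continuous_on UNIV \<delta>'"
    using d1 d2 by (meson has_vector_derivative_continuous continuous_at_imp_continuous_on)+
  have "continuous_on UNIV (\<lambda>t. k1 t + k2 t)"
    unfolding k1_def k2_def using reg pos
    by (intro continuous_intros c c2) (auto simp: less_le)
  then have "open {t. k1 t + k2 t \<noteq> 2}"
    by (intro open_Collect_neq) auto
  show ?thesis
  proof (rule ccontr)
    assume "k1 t + k2 t \<noteq> 2"
    with \<open>open _\<close> obtain e where e: "e > 0" "ball t e \<subseteq> {t. k1 t + k2 t \<noteq> 2}"
      unfolding open_contains_ball by auto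
    from dense[of t "t + e"] e obtain u where "Im (\<delta>' u) \<noteq> 0" "u \<in> ball t e"
      by (auto simp: dist_real_def)
    with nonstationary e show False by auto
  qed
qed

text \<open>By the first integral \<open>k2 = 1 - M / y\<^sup>2\<close>, and \<open>k1 = 2 - k2\<close>, so the Gauss curvature is the
  increasing function \<open>1 - (M / y\<^sup>2)\<^sup>2\<close> of \<open>y\<close>. As a cosine lies between \<open>-1\<close> and \<open>1\<close>, the first
  integral confines \<open>y\<close> to the interval between \<open>\<bar>c - 1/2\<bar>\<close> and \<open>c + 1/2\<close>, the least and the
  greatest distance from a focus to a vertex of the conic. Since \<open>M = (c - 1/2) * (c + 1/2)\<close>, the
  Gauss curvatures at the two ends are \<open>1 - 1 / q\<close> and \<open>1 - q\<close>, whose quotient is \<open>- q\<close>.\<close>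

lemma delaunay_equation_imp_curvature_ratio:
  fixes \<delta> \<delta>' \<delta>'' :: "real \<Rightarrow> complex" and \<eta> M :: real
  defines "c \<equiv> sqrt (1/4 + M)"
  assumes M: "M \<noteq> 0" "-1/4 < M" and eta: "\<bar>\<eta>\<bar> = 1"
    and d1: "\<And>t. (\<delta> has_vector_derivative \<delta>' t) (at t)"
    and d2: "\<And>t. (\<delta>' has_vector_derivative \<delta>'' t) (at t)"
    and c2: "continuous_on UNIV \<delta>''"
    and reg: "\<And>t. \<delta>' t \<noteq> 0" and pos: "\<And>t. Im (\<delta> t) > 0"
    and eqn: "\<And>t. delaunay_equation M \<eta> (\<delta> t) (\<delta>' t)"
    and dense: "\<And>a b. a < b \<Longrightarrow> \<exists>t\<in>{a<..<b}. Im (\<delta>' t) \<noteq> 0"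
    and bulge: "Im (\<delta> tmax) = c + 1/2" and neck: "Im (\<delta> tmin) = \<bar>c - 1/2\<bar>"
  shows "\<exists>N. unit_normal_field (surface_of_revolution \<delta>) N \<and>
     (\<forall>p. mean_curvature (surface_of_revolution \<delta>) N p = 1) \<and>
     (\<exists>Kmax Kmin.
        Kmax \<in> range (gauss_curvature (surface_of_revolution \<delta>) N) \<and>
        (\<forall>p. gauss_curvature (surface_of_revolution \<delta>) N p \<le> Kmax) \<and>
        Kmin \<in> range (gauss_curvature (surface_of_revolution \<delta>) N) \<and>
        (\<forall>p. Kmin \<le> gauss_curvature (surface_of_revolution \<delta>) N p) \<and>
        Kmax / Kmin = - ((1 - sqrt (1 + 4 * M)) / (1 + sqrt (1 + 4 * M)))\<^sup>2)"
proof -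
  define X where "X = surface_of_revolution \<delta>"
  define k1 where
    "k1 = (\<lambda>t. \<eta> * (Im (\<delta>' t) * Re (\<delta>'' t) - Re (\<delta>' t) * Im (\<delta>'' t)) / norm (\<delta>' t) ^ 3)"
  define k2 where "k2 = (\<lambda>t. \<eta> * Re (\<delta>' t) / (norm (\<delta>' t) * Im (\<delta> t)))"
  define N :: param_surface where "N = (\<lambda>p. (\<eta> / norm (\<delta>' (fst p))) *\<^sub>R
       vector [Im (\<delta>' (fst p)), - Re (\<delta>' (fst p)) * cos (snd p), - Re (\<delta>' (fst p)) * sin (snd p)])"
  note curv = curvatures_surface_of_revolution[OF d1 d2 reg pos eta,
      folded X_def N_def]
  have mean0: "mean_curvature X N p = (k1 (fst p) + k2 (fst p)) / 2"
    and gauss0: "gauss_curvature X N p = k1 (fst p) * k2 (fst p)" for p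
    unfolding k1_def k2_def by (rule curv)+
  have sum: "k1 t + k2 t = 2" for t
    unfolding k1_def k2_def by (rule delaunay_equation_imp_curvature_sum[OF d1 d2 c2 reg pos eqn dense])
  have k2: "k2 t = 1 - M / (Im (\<delta> t))\<^sup>2" for t
    using eqn[of t] reg[of t] pos[of t]
    by (simp add: k2_def delaunay_equation_def field_simps power2_eq_square)
  have gauss: "gauss_curvature X N p = 1 - (M / (Im (\<delta> (fst p)))\<^sup>2)\<^sup>2" for p
  proof -
    have "k1 (fst p) = 2 - k2 (fst p)" using sum[of "fst p"] by simp
    then have "gauss_curvature X N p = (2 - k2 (fst p)) * k2 (fst p)" using gauss0 by simp
    also have "\<dots> = 1 - (M / (Im (\<delta> (fst p)))\<^sup>2)\<^sup>2"
      unfolding k2 by (simp add: algebra_simps power2_eq_square)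
    finally show ?thesis .
  qed
  have c: "c > 0" "c\<^sup>2 = 1/4 + M" using M by (simp_all add: c_def)
  have factor: "M = (c - 1/2) * (c + 1/2)" using c(2) by (simp add: algebra_simps power2_eq_square)
  have c_half: "c \<noteq> 1/2" using M factor by auto
  have range: "\<bar>c - 1/2\<bar> \<le> Im (\<delta> t)" "Im (\<delta> t) \<le> c + 1/2" for t
  proof -
    define y where "y = Im (\<delta> t)"
    have y: "y > 0" using pos by (simp add: y_def)
    have "\<bar>y\<^sup>2 - M\<bar> * norm (\<delta>' t) = y * \<bar>Re (\<delta>' t)\<bar>"
      using eqn[of t] eta y unfolding delaunay_equation_def y_def[symmetric]
      by (metis abs_mult abs_norm_cancel abs_of_pos mult_1)
    also have "\<dots> \<le> y * norm (\<delta>' t)"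
      using y abs_Re_le_cmod by (intro mult_left_mono) auto
    finally have "\<bar>y\<^sup>2 - M\<bar> \<le> y"
      using reg[of t] by simp
    moreover have "(y - (c + 1/2)) * (y + (c - 1/2)) = y\<^sup>2 - M - y"
      "(y + (c + 1/2)) * (y - (c - 1/2)) = y\<^sup>2 - M + y"
      unfolding factor by (simp_all add: field_simps power2_eq_square)
    ultimately have "(y - (c + 1/2)) * (y + (c - 1/2)) \<le> 0" "(y + (c + 1/2)) * (y - (c - 1/2)) \<ge> 0"
      by auto
    then show "\<bar>c - 1/2\<bar> \<le> Im (\<delta> t)" "Im (\<delta> t) \<le> c + 1/2"
      using y c(1) unfolding y_def[symmetric] by (auto simp: mult_le_0_iff zero_le_mult_iff abs_le_iff)
  qed
  define q where "q = ((c - 1/2) / (c + 1/2))\<^sup>2"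
  have q: "0 < q" "q < 1"
  proof -
    show "0 < q" using c c_half by (simp add: q_def)
    have "\<bar>(c - 1/2) / (c + 1/2)\<bar> < 1" using c by (auto simp: abs_if field_simps)
    then show "q < 1" unfolding q_def by (simp add: abs_square_less_1)
  qed
  have Kmax: "1 - (M / (c + 1/2)\<^sup>2)\<^sup>2 = 1 - q"
    using c unfolding q_def factor by (simp add: power2_eq_square)
  have Kmin: "1 - (M / \<bar>c - 1/2\<bar>\<^sup>2)\<^sup>2 = 1 - 1 / q"
    using c c_half unfolding q_def factor power2_abs by (simp add: power2_eq_square)
  have mono: "(M / b\<^sup>2)\<^sup>2 \<le> (M / a\<^sup>2)\<^sup>2" if "0 < a" "a \<le> b" for a b :: real
    unfolding power_divide using that by (intro divide_left_mono power_mono mult_pos_pos) auto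
  have "unit_normal_field X N" by (rule curv(1))
  moreover have "\<forall>p. mean_curvature X N p = 1"
    using mean0 sum by simp
  moreover have "1 - q \<in> range (gauss_curvature X N)"
    by (rule range_eqI[of _ _ "(tmax, 0)"]) (simp add: gauss bulge Kmax)
  moreover have "1 - 1 / q \<in> range (gauss_curvature X N)"
    by (rule range_eqI[of _ _ "(tmin, 0)"]) (simp only: gauss fst_conv neck Kmin)
  moreover have "gauss_curvature X N p \<le> 1 - q" "1 - 1 / q \<le> gauss_curvature X N p" for p
    unfolding gauss Kmax[symmetric] Kmin[symmetric]
    using mono[OF pos range(2)] mono[OF _ range(1)] c_half by auto
  moreover have "(1 - q) / (1 - 1 / q) = - ((1 - sqrt (1 + 4 * M)) / (1 + sqrt (1 + 4 * M)))\<^sup>2"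
  proof -
    have "1 + 4 * M = 4 * (1/4 + M)" by simp
    then have "sqrt (1 + 4 * M) = 2 * c" unfolding c_def by (metis real_sqrt_four real_sqrt_mult)
    moreover have "(1 - 2 * c) / (1 + 2 * c) = - ((c - 1/2) / (c + 1/2))"
      using c(1) by (simp add: field_simps)
    moreover have "(1 - q) / (1 - 1 / q) = - q"
      using q by (simp add: field_simps)
    ultimately show ?thesis by (simp add: q_def)
  qed
  ultimately show ?thesis unfolding X_def by blast
qed

section \<open>Gluing arcs\<close>

text \<open>The properties that a profile curve inherits from its pieces. The last one excludes arcs of
  cylinders, on which the first integral does not determine the mean curvature.\<close>

definition focal_arc :: "real \<Rightarrow> real \<Rightarrow> (real \<Rightarrow> complex) \<Rightarrow> bool" where
  "focal_arc M \<eta> \<alpha> \<longleftrightarrow> (\<exists>\<alpha>'. (\<forall>t. (\<alpha> has_vector_derivative \<alpha>' t) (at t)) \<and>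
     (\<forall>t. Im (\<alpha> t) > 0) \<and> (\<forall>t. delaunay_equation M \<eta> (\<alpha> t) (\<alpha>' t)) \<and>
     (\<forall>a b. a < b \<longrightarrow> (\<exists>t\<in>{a<..<b}. Im (\<alpha>' t) \<noteq> 0)))"

text \<open>A regular change of parameter multiplies the velocity by a positive number, which preserves the
  first integral, and its being onto makes every height of the arc occur on the curve.\<close>

lemma traverses_focal_arc:
  assumes arc: "focal_arc M \<eta> \<alpha>" and trav: "traverses \<delta> S (\<lambda>t. \<alpha> t + of_real \<tau>)" and "open S"
    and d: "\<And>t. (\<delta> has_vector_derivative \<delta>' t) (at t)"
  shows "t \<in> S \<Longrightarrow> Im (\<delta> t) > 0"
    and "t \<in> S \<Longrightarrow> delaunay_equation M \<eta> (\<delta> t) (\<delta>' t)"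
    and "a < b \<Longrightarrow> {a<..<b} \<subseteq> S \<Longrightarrow> \<exists>t\<in>{a<..<b}. Im (\<delta>' t) \<noteq> 0"
    and "\<exists>t. Im (\<delta> t) = Im (\<alpha> s)"
proof -
  from arc obtain \<alpha>' where a': "\<And>t. (\<alpha> has_vector_derivative \<alpha>' t) (at t)"
    and pos: "\<And>t. Im (\<alpha> t) > 0" and eqn: "\<And>t. delaunay_equation M \<eta> (\<alpha> t) (\<alpha>' t)"
    and dense: "\<And>a b. a < b \<Longrightarrow> \<exists>t\<in>{a<..<b}. Im (\<alpha>' t) \<noteq> 0"
    unfolding focal_arc_def by blast
  from trav obtain \<phi> \<phi>' where p': "\<And>t. t \<in> S \<Longrightarrow> (\<phi> has_real_derivative \<phi>' t) (at t)"
    and p'pos: "\<And>t. t \<in> S \<Longrightarrow> deriv \<phi> t > 0" and onto: "\<phi> ` S = UNIV"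
    and eq: "\<And>t. t \<in> S \<Longrightarrow> \<delta> t = \<alpha> (\<phi> t) + of_real \<tau>"
    unfolding traverses_def C2_on_def has_real_derivative_iff_has_vector_derivative by blast
  have p'pos: "\<phi>' t > 0" if "t \<in> S" for t
    using p'pos[OF that] DERIV_imp_deriv[OF p'[OF that]] by simp
  have d': "\<delta>' t = \<phi>' t *\<^sub>R \<alpha>' (\<phi> t)" if "t \<in> S" for t
  proof -
    have "((\<lambda>t. \<alpha> (\<phi> t) + of_real \<tau>) has_vector_derivative \<phi>' t *\<^sub>R \<alpha>' (\<phi> t)) (at t)"
      using vector_diff_chain_at[OF p'[OF that, unfolded has_real_derivative_iff_has_vector_derivative] a']
      by (auto intro!: derivative_eq_intros simp: o_def)
    then have "(\<delta> has_vector_derivative \<phi>' t *\<^sub>R \<alpha>' (\<phi> t)) (at t)"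
      by (rule has_vector_derivative_transform_within_open[OF _ \<open>open S\<close> that]) (simp add: eq)
    then show ?thesis using d vector_derivative_unique_at by blast
  qed
  show "t \<in> S \<Longrightarrow> Im (\<delta> t) > 0" using pos eq by simp
  show "t \<in> S \<Longrightarrow> delaunay_equation M \<eta> (\<delta> t) (\<delta>' t)"
    using eqn[of "\<phi> t"] p'pos[of t] by (simp add: delaunay_equation_def eq d')
  show "\<exists>t. Im (\<delta> t) = Im (\<alpha> s)"
  proof -
    have "s \<in> \<phi> ` S" using onto by simp
    then obtain t where "t \<in> S" "\<phi> t = s" by auto
    then show ?thesis by (intro exI[of _ t]) (simp add: eq)
  qed
  assume ab: "a < b" "{a<..<b} \<subseteq> S"
  define p q where "p = a + (b - a) / 3" and "q = a + 2 * (b - a) / 3"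
  have pq: "a < p" "p < q" "q < b" using ab by (auto simp: p_def q_def field_simps)
  then have sub: "{p..q} \<subseteq> S" using ab(2) by (force intro!: subsetD[OF ab(2)])
  have "\<phi> p < \<phi> q"
    using pq(2) by (rule DERIV_pos_imp_increasing) (use sub p' p'pos in \<open>force\<close>)
  from dense[OF this] obtain s where s: "\<phi> p < s" "s < \<phi> q" "Im (\<alpha>' s) \<noteq> 0" by auto
  have "continuous_on {p..q} \<phi>"
    using sub p' by (meson DERIV_isCont continuous_at_imp_continuous_on subsetD)
  then obtain t where "p \<le> t" "t \<le> q" "\<phi> t = s"
    using IVT'[of \<phi> p s q] s pq by auto
  with s sub d' p'pos[of t] pq show "\<exists>t\<in>{a<..<b}. Im (\<delta>' t) \<noteq> 0"
    by (intro bexI[of _ t]) (auto simp: subset_iff less_le)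
qed

text \<open>At a junction two arcs meet only at infinity of their own parameters, so the first integral is
  carried to the junction by continuity of the velocity. The height stays positive there because
  \<open>y = 0\<close> in the first integral would give \<open>M = 0\<close>.\<close>

lemma delaunay_equation_extends:
  assumes d: "\<And>t. (\<delta> has_vector_derivative \<delta>' t) (at t)" and c: "continuous_on UNIV \<delta>'"
    and reg: "\<delta>' x \<noteq> 0" and "M \<noteq> 0" and "x < z"
    and right: "\<And>t. x < t \<Longrightarrow> t < z \<Longrightarrow> Im (\<delta> t) > 0 \<and> delaunay_equation M \<eta> (\<delta> t) (\<delta>' t)"
  shows "Im (\<delta> x) > 0" and "delaunay_equation M \<eta> (\<delta> x) (\<delta>' x)"
proof -
  have ev: "\<forall>\<^sub>F t in at_right x. Im (\<delta> t) > 0 \<and> delaunay_equation M \<eta> (\<delta> t) (\<delta>' t)"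
    using \<open>x < z\<close> right by (auto simp: eventually_at_right)
  have "isCont \<delta> x" "isCont \<delta>' x"
    using d c by (auto intro: has_vector_derivative_continuous simp: continuous_on_eq_continuous_at)
  then have lim: "(\<delta> \<longlongrightarrow> \<delta> x) (at_right x)" "(\<delta>' \<longlongrightarrow> \<delta>' x) (at_right x)"
    by (auto simp: isCont_def intro: tendsto_within_subset)
  have "((\<lambda>t. ((Im (\<delta> t))\<^sup>2 - M) * norm (\<delta>' t) - \<eta> * Im (\<delta> t) * Re (\<delta>' t)) \<longlongrightarrow>
      ((Im (\<delta> x))\<^sup>2 - M) * norm (\<delta>' x) - \<eta> * Im (\<delta> x) * Re (\<delta>' x)) (at_right x)"
    by (intro tendsto_intros lim)
  moreover have "((\<lambda>t. ((Im (\<delta> t))\<^sup>2 - M) * norm (\<delta>' t) - \<eta> * Im (\<delta> t) * Re (\<delta>' t)) \<longlongrightarrow> 0)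
      (at_right x)"
    by (rule tendsto_eventually, rule eventually_mono[OF ev]) (simp add: delaunay_equation_def)
  ultimately show eqn: "delaunay_equation M \<eta> (\<delta> x) (\<delta>' x)"
    using tendsto_unique[OF trivial_limit_at_right_real] by (fastforce simp: delaunay_equation_def)
  have "Im (\<delta> x) \<ge> 0"
    by (rule tendsto_lowerbound[OF tendsto_Im[OF lim(1)]]) (auto intro: eventually_mono[OF ev])
  moreover have "Im (\<delta> x) \<noteq> 0"
    using eqn reg \<open>M \<noteq> 0\<close> by (auto simp: delaunay_equation_def)
  ultimately show "Im (\<delta> x) > 0" by simp
qed

section \<open>The traces of the foci\<close>

lemma arc_length_has_real_derivative:
  assumes "continuous_on UNIV (\<lambda>t. norm (vector_derivative \<gamma> (at t)))"
  shows "(arc_length \<gamma> has_real_derivative norm (vector_derivative \<gamma> (at t))) (at t)"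
proof -
  have "(at t within {min 0 (t - 1)..max 0 (t + 1)}) = at t"
    by (intro at_within_interior) auto
  moreover have "min 0 (t - 1) \<le> t" "t \<le> max 0 (t + 1)"
    by auto
  ultimately show ?thesis
    using interval_integral_FTC2[of "min 0 (t - 1)" 0 "max 0 (t + 1)"
        "\<lambda>t. norm (vector_derivative \<gamma> (at t))" t] continuous_on_subset[OF assms]
    by (auto simp: arc_length_def[abs_def] zero_ereal_def has_real_derivative_iff_has_vector_derivative
             split del: if_split)
qed

lemma rolling_trace_eq:
  assumes "(\<gamma> has_vector_derivative \<gamma>' t) (at t)"
  shows "rolling_trace \<gamma> F t = of_real (arc_length \<gamma> t) + (F - \<gamma> t) * cnj (\<gamma>' t) / of_real (norm (\<gamma>' t))"
proof (cases "\<gamma>' t = 0")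
  case True
  then show ?thesis
    by (simp add: rolling_trace_def rolling_motion_def vector_derivative_at[OF assms])
next
  case False
  then have "z / sgn (\<gamma>' t) = z * cnj (\<gamma>' t) / of_real (norm (\<gamma>' t))" for z
    by (simp add: complex_div_cnj[of z] norm_sgn) (simp add: sgn_eq)
  then show ?thesis
    by (simp add: rolling_trace_def rolling_motion_def vector_derivative_at[OF assms])
qed

text \<open>Put \<open>w = (F - \<gamma>) * cnj \<gamma>' / \<bar>\<gamma>'\<bar>\<close>, the vector from the point of contact to the rolled focus \<open>F = e\<close>.
  Here \<open>r\<close> is the focal distance of the point of contact \<open>\<gamma>\<close> and \<open>v\<^sup>2 = r * (1 - r)\<close>, the product of the
  two focal distances, is the square of its speed; the product \<open>(F - \<gamma>) * cnj \<gamma>'\<close> contains the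
  factor \<open>r\<close>, which gives \<open>w = r / v * (b * \<i> - e * sin t)\<close>. The point of contact being the
  instantaneous centre of rotation, the velocity of the trace is perpendicular to \<open>w\<close>. Both foci
  are covered, by the two signs of \<open>e\<close>.\<close>

lemma rolling_trace_ellipse:
  fixes M e :: real
  assumes M: "M < 0" and e: "e\<^sup>2 = 1/4 + M"
  defines "b \<equiv> sqrt (- M)" and "r \<equiv> \<lambda>t. 1/2 - e * cos t" and "v \<equiv> \<lambda>t. sqrt (1/4 - (e * cos t)\<^sup>2)"
  defines "\<alpha> \<equiv> rolling_trace (ellipse_param M) (of_real e)"
  shows "Im (\<alpha> t) = b * r t / v t"
    and "(\<alpha> has_vector_derivative of_real (b * r t / (2 * v t ^ 3)) * Complex b (e * sin t)) (at t)"
    and "r t > 0" "v t > 0"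
proof -
  have b: "b > 0" "b\<^sup>2 = - M" using M by (simp_all add: b_def)
  have bound: "\<bar>e * cos t\<bar> < 1/2" for t
  proof -
    have "\<bar>e\<bar>\<^sup>2 < (1/2)\<^sup>2" using e M by (simp add: power2_eq_square)
    then have "\<bar>e\<bar> < 1/2" by (rule power2_less_imp_less) simp
    moreover have "\<bar>e * cos t\<bar> \<le> \<bar>e\<bar> * 1"
      unfolding abs_mult by (intro mult_left_mono) auto
    ultimately show ?thesis by simp
  qed
  have r: "r t > 0" for t using bound[of t] by (auto simp: r_def)
  have vpos: "1/4 - (e * cos t)\<^sup>2 > 0" for t
    using power_strict_mono[OF bound[of t], of 2] by (simp add: power2_eq_square)
  then have v: "v t > 0" and v2: "(v t)\<^sup>2 = 1/4 - (e * cos t)\<^sup>2" for t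
    by (simp_all add: v_def less_imp_le)
  have sc: "(sin t)\<^sup>2 = 1 - (cos t)\<^sup>2" for t :: real by (simp add: sin_squared_eq)
  define g where "g = (\<lambda>t. Complex (- sin t / 2) (b * cos t))"
  have g: "(ellipse_param M has_vector_derivative g t) (at t)" for t
    unfolding has_vector_derivative_complex_iff ellipse_param_def g_def b_def
    by (auto intro!: derivative_eq_intros)
  have "(norm (g t))\<^sup>2 = (v t)\<^sup>2" for t
  proof -
    have "(norm (g t))\<^sup>2 = (sin t)\<^sup>2 / 4 + b\<^sup>2 * (cos t)\<^sup>2"
      by (simp add: cmod_power2 g_def power_mult_distrib power_divide)
    also have "\<dots> = (v t)\<^sup>2"
      unfolding v2 b(2) sc power_mult_distrib e by (simp add: field_simps)
    finally show ?thesis .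
  qed
  then have norm_g: "norm (g t) = v t" for t
    using v[of t] by (metis norm_ge_zero less_imp_le power2_eq_iff_nonneg)
  have cont: "continuous_on UNIV v" unfolding v_def by (intro continuous_intros)
  then have s: "(arc_length (ellipse_param M) has_real_derivative v t) (at t)" for t
    using arc_length_has_real_derivative[of "ellipse_param M" t] norm_g vector_derivative_at[OF g] by simp
  have split: "(of_real e - ellipse_param M t) * cnj (g t) = of_real (r t) * Complex (- e * sin t) b" for t
  proof (rule complex_eqI)
    show "Re ((of_real e - ellipse_param M t) * cnj (g t)) = Re (of_real (r t) * Complex (- e * sin t) b)"
      using b(2) e by (simp add: ellipse_param_def g_def r_def flip: b_def) algebra
    show "Im ((of_real e - ellipse_param M t) * cnj (g t)) = Im (of_real (r t) * Complex (- e * sin t) b)"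
      using sc[of t] by (simp add: ellipse_param_def g_def r_def flip: b_def) algebra
  qed
  define w where "w = (\<lambda>t. r t / v t)"
  have \<alpha>: "\<alpha> = (\<lambda>t. Complex (arc_length (ellipse_param M) t - w t * (e * sin t)) (w t * b))"
    unfolding \<alpha>_def
    by (rule ext) (simp add: rolling_trace_eq[of _ g, OF g] norm_g split w_def complex_eq_iff Re_divide_of_real Im_divide_of_real)
  show "Im (\<alpha> t) = b * r t / v t" by (simp add: \<alpha> w_def)
  have "(v has_real_derivative e\<^sup>2 * cos t * sin t / v t) (at t)" for t
    unfolding v_def using vpos[of t]
    by (auto intro!: derivative_eq_intros simp: field_simps power2_eq_square)
  moreover have "(r has_real_derivative e * sin t) (at t)" for t
    unfolding r_def by (auto intro!: derivative_eq_intros)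
  moreover have "(e * sin t * v t - r t * (e\<^sup>2 * cos t * sin t / v t)) / (v t * v t) = e * sin t * r t / (2 * v t ^ 3)" for t
  proof -
    have "e * sin t * v t ^ 2 - r t * (e\<^sup>2 * cos t * sin t) = e * sin t * r t / 2"
      unfolding v2 r_def by (simp add: algebra_simps power2_eq_square)
    then show ?thesis using v[of t] by (simp add: field_simps power2_eq_square power3_eq_cube)
  qed
  ultimately have dw: "(w has_real_derivative e * sin t * r t / (2 * v t ^ 3)) (at t)" for t
    unfolding w_def using v[of t] by (auto intro!: derivative_eq_intros)
  \<comment> \<open>The abscissa of the trace is the length rolled so far, with derivative \<open>v\<close>, plus that of
    the vector to the focus.\<close>
  have "v t - (e * sin t * r t / (2 * v t ^ 3) * (e * sin t) + cos t * e * w t) = b * r t / (2 * v t ^ 3) * b" for t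
  proof -
    have "2 * (v t)\<^sup>2 * (v t)\<^sup>2 - r t * (e * sin t)\<^sup>2 - 2 * r t * (v t)\<^sup>2 * (e * cos t) = b\<^sup>2 * r t"
      unfolding v2 r_def power_mult_distrib b(2) sc using e by algebra
    then show ?thesis using v[of t] by (simp add: w_def field_simps power2_eq_square power3_eq_cube)
  qed
  then show "(\<alpha> has_vector_derivative of_real (b * r t / (2 * v t ^ 3)) * Complex b (e * sin t)) (at t)"
    unfolding \<alpha> has_vector_derivative_complex_iff
    by (auto intro!: derivative_eq_intros s dw)
  show "r t > 0" "v t > 0" using r v by auto
qed

text \<open>The same computation with hyperbolic functions. Now \<open>r\<close> is a signed focal distance: it is
  negative for the focus inside the branch (\<open>e > 0\<close>) and positive for the other one, so the two
  foci are traced on different sides of the axis.\<close>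

lemma rolling_trace_hyperbola:
  fixes M e :: real
  assumes M: "M > 0" and e: "e\<^sup>2 = 1/4 + M"
  defines "b \<equiv> sqrt M" and "r \<equiv> \<lambda>t. 1/2 - e * cosh t" and "v \<equiv> \<lambda>t. sqrt ((e * cosh t)\<^sup>2 - 1/4)"
  defines "\<alpha> \<equiv> rolling_trace (hyperbola_param M) (of_real e)"
  shows "Im (\<alpha> t) = b * r t / v t"
    and "(\<alpha> has_vector_derivative
           of_real (b * r t / (2 * v t ^ 3)) * Complex (- b) (e * sinh t)) (at t)"
    and "v t > 0" "(v t)\<^sup>2 = (e * cosh t)\<^sup>2 - 1/4"
proof -
  have b: "b > 0" "b\<^sup>2 = M" using M by (simp_all add: b_def)
  have vpos: "(e * cosh t)\<^sup>2 - 1/4 > 0" for t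
  proof -
    have "1/4 * 1 < e\<^sup>2 * (cosh t)\<^sup>2"
      unfolding e using M by (intro mult_less_le_imp_less) (auto simp: cosh_real_ge_1)
    then show ?thesis by (simp add: power_mult_distrib)
  qed
  then have v: "v t > 0" and v2: "(v t)\<^sup>2 = (e * cosh t)\<^sup>2 - 1/4" for t
    by (simp_all add: v_def less_imp_le)
  have sc: "(sinh t)\<^sup>2 = (cosh t)\<^sup>2 - 1" for t :: real by (simp add: sinh_square_eq)
  define g where "g = (\<lambda>t. Complex (sinh t / 2) (b * cosh t))"
  have g: "(hyperbola_param M has_vector_derivative g t) (at t)" for t
    unfolding has_vector_derivative_complex_iff hyperbola_param_def g_def b_def
    by (auto intro!: derivative_eq_intros)
  have "(norm (g t))\<^sup>2 = (v t)\<^sup>2" for t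
  proof -
    have "(norm (g t))\<^sup>2 = (sinh t)\<^sup>2 / 4 + b\<^sup>2 * (cosh t)\<^sup>2"
      by (simp add: cmod_power2 g_def power_mult_distrib power_divide)
    also have "\<dots> = (v t)\<^sup>2"
      unfolding v2 b(2) sc power_mult_distrib e by (simp add: field_simps)
    finally show ?thesis .
  qed
  then have norm_g: "norm (g t) = v t" for t
    using v[of t] by (metis norm_ge_zero less_imp_le power2_eq_iff_nonneg)
  have cont: "continuous_on UNIV v" unfolding v_def by (intro continuous_intros)
  then have s: "(arc_length (hyperbola_param M) has_real_derivative v t) (at t)" for t
    using arc_length_has_real_derivative[of "hyperbola_param M" t] norm_g vector_derivative_at[OF g] by simp
  have split: "(of_real e - hyperbola_param M t) * cnj (g t) = of_real (r t) * Complex (e * sinh t) b" for t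
  proof (rule complex_eqI)
    show "Re ((of_real e - hyperbola_param M t) * cnj (g t)) = Re (of_real (r t) * Complex (e * sinh t) b)"
    proof -
      have "(e - cosh t / 2) * (sinh t / 2) - b * sinh t * (b * cosh t)
          = (1 / 2 - e * cosh t) * (e * sinh t) + sinh t * cosh t * (e\<^sup>2 - (1/4 + b\<^sup>2))"
        by (simp add: algebra_simps power2_eq_square)
      then show ?thesis
        using b(2) e by (simp add: hyperbola_param_def g_def r_def flip: b_def)
    qed
    show "Im ((of_real e - hyperbola_param M t) * cnj (g t)) = Im (of_real (r t) * Complex (e * sinh t) b)"
      using sc[of t] by (simp add: hyperbola_param_def g_def r_def flip: b_def) algebra
  qed
  define w where "w = (\<lambda>t. r t / v t)"
  have \<alpha>: "\<alpha> = (\<lambda>t. Complex (arc_length (hyperbola_param M) t + w t * (e * sinh t)) (w t * b))"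
    unfolding \<alpha>_def
    by (rule ext) (simp add: rolling_trace_eq[of _ g, OF g] norm_g split w_def complex_eq_iff Re_divide_of_real Im_divide_of_real)
  show "Im (\<alpha> t) = b * r t / v t" by (simp add: \<alpha> w_def)
  have "(v has_real_derivative e\<^sup>2 * cosh t * sinh t / v t) (at t)" for t
    unfolding v_def using vpos[of t]
    by (auto intro!: derivative_eq_intros simp: field_simps power2_eq_square)
  moreover have "(r has_real_derivative - e * sinh t) (at t)" for t
    unfolding r_def by (auto intro!: derivative_eq_intros)
  moreover have "(- e * sinh t * v t - r t * (e\<^sup>2 * cosh t * sinh t / v t)) / (v t * v t) = e * sinh t * r t / (2 * v t ^ 3)" for t
  proof -
    have "- e * sinh t * v t ^ 2 - r t * (e\<^sup>2 * cosh t * sinh t) = e * sinh t * r t / 2"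
      unfolding v2 r_def by (simp add: algebra_simps power2_eq_square)
    then show ?thesis using v[of t] by (simp add: field_simps power2_eq_square power3_eq_cube)
  qed
  ultimately have dw: "(w has_real_derivative e * sinh t * r t / (2 * v t ^ 3)) (at t)" for t
    unfolding w_def using v[of t] by (auto intro!: derivative_eq_intros)
  \<comment> \<open>The abscissa of the trace is the length rolled so far, with derivative \<open>v\<close>, plus that of
    the vector to the focus.\<close>
  have "v t + (e * sinh t * r t / (2 * v t ^ 3) * (e * sinh t) + cosh t * e * w t) = - (b * r t / (2 * v t ^ 3) * b)" for t
  proof -
    have "2 * (v t)\<^sup>2 * (v t)\<^sup>2 + r t * (e * sinh t)\<^sup>2 + 2 * r t * (v t)\<^sup>2 * (e * cosh t) = - (b\<^sup>2 * r t)"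
      unfolding v2 r_def power_mult_distrib b(2) sc using e by algebra
    then show ?thesis using v[of t] by (simp add: w_def field_simps power2_eq_square power3_eq_cube)
  qed
  then show "(\<alpha> has_vector_derivative of_real (b * r t / (2 * v t ^ 3)) * Complex (- b) (e * sinh t)) (at t)"
    unfolding \<alpha> has_vector_derivative_complex_iff
    by (auto intro!: derivative_eq_intros s dw)
  show "v t > 0" "(v t)\<^sup>2 = (e * cosh t)\<^sup>2 - 1/4" using v v2 by auto
qed

lemma exists_sin_nonzero: "a < b \<Longrightarrow> \<exists>t\<in>{a<..<b}. sin t \<noteq> (0::real)"
proof (rule ccontr)
  assume ab: "a < b" and "\<not> (\<exists>t\<in>{a<..<b}. sin t \<noteq> 0)"
  then have zero: "t \<in> {a<..<b} \<Longrightarrow> sin t = 0" for t by blast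
  define m where "m = (a + b) / 2"
  have "sin m = 0" using ab by (auto simp: m_def intro!: zero)
  have "sin m = sin y" if "\<bar>m - y\<bar> < (b - a) / 2" for y
  proof -
    have "y \<in> {a<..<b}" using that by (auto simp: m_def abs_less_iff field_simps)
    then show ?thesis using zero \<open>sin m = 0\<close> by simp
  qed
  then have "cos m = 0"
    using ab by (intro DERIV_local_const[OF DERIV_sin, of "(b - a) / 2"]) auto
  with \<open>sin m = 0\<close> show False using sin_cos_squared_add[of m] by simp
qed

lemma exists_sinh_nonzero: "a < b \<Longrightarrow> \<exists>t\<in>{a<..<b}. sinh t \<noteq> (0::real)"
proof -
  assume "a < b"
  then obtain p q where "a < p" "p < q" "q < b" by (meson dense)
  then show ?thesis
    using bexI[of "\<lambda>t. sinh t \<noteq> 0" p] bexI[of "\<lambda>t. sinh t \<noteq> 0" q] by (cases "p = 0") auto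
qed

text \<open>Dividing the velocity by its positive factor leaves \<open>b + \<i> * e * sin t\<close>, of modulus \<open>v\<close>, so the
  first integral reduces to \<open>v\<^sup>2 = r * (1 - r)\<close>. The extreme heights occur when a vertex of the major
  axis touches the line.\<close>

lemma focal_arc_ellipse:
  assumes M: "M < 0" and e: "e\<^sup>2 = 1/4 + M" and "e \<noteq> 0"
  shows "focal_arc M 1 (rolling_trace (ellipse_param M) (of_real e))"
    and "Im (rolling_trace (ellipse_param M) (of_real e) 0) = 1/2 - e"
    and "Im (rolling_trace (ellipse_param M) (of_real e) pi) = 1/2 + e"
proof -
  define b where "b = sqrt (- M)"
  define r v where "r = (\<lambda>t. 1/2 - e * cos t)" and "v = (\<lambda>t. sqrt (1/4 - (e * cos t)\<^sup>2))"
  define \<alpha> where "\<alpha> = rolling_trace (ellipse_param M) (of_real e)"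
  note trace = rolling_trace_ellipse[OF M e, folded b_def]
  have im: "Im (\<alpha> t) = b * r t / v t" and r: "r t > 0" and v: "v t > 0" for t
    using trace unfolding \<alpha>_def r_def v_def by auto
  define h where "h = (\<lambda>t. b * r t / (2 * v t ^ 3))"
  have d: "(\<alpha> has_vector_derivative of_real (h t) * Complex b (e * sin t)) (at t)" for t
    using trace(2) unfolding \<alpha>_def r_def v_def h_def by auto
  have b: "b > 0" "b\<^sup>2 = - M" using M by (simp_all add: b_def)
  have h: "h t > 0" for t using b r v by (simp add: h_def)
  have v2: "(v t)\<^sup>2 = 1/4 - (e * cos t)\<^sup>2" for t
    using v[of t] by (simp add: v_def)
  have norm: "norm (Complex b (e * sin t)) = v t" for t
  proof -
    have "b\<^sup>2 + (e * sin t)\<^sup>2 = (v t)\<^sup>2"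
      unfolding v2 power_mult_distrib sin_squared_eq e b(2) by (simp add: field_simps)
    then show ?thesis using v[of t] by (simp add: cmod_def)
  qed
  have eqn: "delaunay_equation M 1 (\<alpha> t) (of_real (h t) * Complex b (e * sin t))" for t
  proof -
    have "(r t)\<^sup>2 + (v t)\<^sup>2 = r t"
      unfolding v2 r_def by (simp add: field_simps power2_eq_square)
    then have "b\<^sup>2 * ((r t)\<^sup>2 + (v t)\<^sup>2) * v t * h t = b\<^sup>2 * r t * v t * h t" by simp
    moreover have "M = - b\<^sup>2" using b by simp
    ultimately show ?thesis
      using v[of t] h[of t]
      by (simp add: delaunay_equation_def norm_mult norm im field_simps power2_eq_square)
  qed
  show "focal_arc M 1 (rolling_trace (ellipse_param M) (of_real e))"
    unfolding focal_arc_def \<alpha>_def[symmetric]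
  proof (intro exI conjI allI impI)
    show "Im (\<alpha> t) > 0" for t using im b r v by simp
    show "\<exists>t\<in>{a<..<b}. Im (of_real (h t) * Complex b' (e * sin t)) \<noteq> 0" if "a < b" for a b b'
      using exists_sin_nonzero[OF that] \<open>e \<noteq> 0\<close> h by (auto simp: less_le)
  qed (rule d eqn)+
  have "b * (1/2 - e) / sqrt (1/4 - e\<^sup>2) = 1/2 - e" "b * (1/2 + e) / sqrt (1/4 - e\<^sup>2) = 1/2 + e"
    using b(1) by (simp_all add: e b_def)
  then show "Im (rolling_trace (ellipse_param M) (of_real e) 0) = 1/2 - e"
    "Im (rolling_trace (ellipse_param M) (of_real e) pi) = 1/2 + e"
    unfolding \<alpha>_def[symmetric] im r_def v_def by simp_all
qed

text \<open>After the reflection both arcs have the form of one formula with a sign \<open>\<sigma>\<close>, and \<open>r\<close> is a true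
  distance. The arcs of odd index run backwards in the axial direction: these are the loops of
  the nodoid.\<close>

lemma nodoid_arc_explicit:
  fixes M :: real and k :: int
  assumes M: "M > 0"
  defines "b \<equiv> sqrt M" and "c \<equiv> sqrt (1/4 + M)" and "\<sigma> \<equiv> if even k then 1 else - 1"
  defines "r \<equiv> \<lambda>t. c * cosh t - \<sigma> / 2" and "v \<equiv> \<lambda>t. sqrt ((c * cosh t)\<^sup>2 - 1/4)"
  shows "Im (nodoid_arc M k t) = b * r t / v t"
    and "(nodoid_arc M k has_vector_derivative
      of_real (\<sigma> * b * r t / (2 * v t ^ 3)) * Complex b (c * sinh t)) (at t)"
    and "r t > 0" and "v t > 0" and "(v t)\<^sup>2 = (c * cosh t)\<^sup>2 - 1/4"
proof -
  have e: "(\<sigma> * c)\<^sup>2 = 1/4 + M" using M by (simp add: \<sigma>_def c_def)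
  have sq: "(\<sigma> * c * cosh s)\<^sup>2 = (c * cosh s)\<^sup>2" for s by (simp add: \<sigma>_def)
  note trace = rolling_trace_hyperbola[OF M e, folded b_def, unfolded sq]
  show "v t > 0" "(v t)\<^sup>2 = (c * cosh t)\<^sup>2 - 1/4" using trace(3,4) by (simp_all add: v_def)
  have c: "c > 1/2" unfolding c_def using M by (intro real_less_rsqrt) (simp add: power2_eq_square)
  then have "1/2 * 1 < c * cosh t" by (intro mult_less_le_imp_less) (auto simp: cosh_real_ge_1)
  then show "r t > 0" by (simp add: r_def \<sigma>_def)
  have r: "1/2 - \<sigma> * c * cosh t = - \<sigma> * r t" for t by (simp add: \<sigma>_def r_def)
  have v_eq: "sqrt ((c * cosh t)\<^sup>2 - 1/4) = v t" by (simp add: v_def)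
  note trace = trace(1,2)[of t, unfolded r v_eq]
  show "Im (nodoid_arc M k t) = b * r t / v t"
    using trace(1) by (auto simp: nodoid_arc_def \<sigma>_def v_def c_def)
  show "(nodoid_arc M k has_vector_derivative
      of_real (\<sigma> * b * r t / (2 * v t ^ 3)) * Complex b (c * sinh t)) (at t)"
  proof (cases "even k")
    case True
    then have "nodoid_arc M k = (\<lambda>t. cnj (rolling_trace (hyperbola_param M) (of_real (\<sigma> * c)) t))"
      by (simp add: nodoid_arc_def fun_eq_iff \<sigma>_def c_def)
    moreover have "cnj (of_real (b * (- \<sigma> * r t) / (2 * v t ^ 3)) * Complex (- b) (\<sigma> * c * sinh t))
        = of_real (\<sigma> * b * r t / (2 * v t ^ 3)) * Complex b (c * sinh t)"
      using True by (simp add: \<sigma>_def complex_eq_iff)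
    ultimately show ?thesis
      using has_vector_derivative_cnj[OF trace(2)] by simp
  next
    case False
    then have "nodoid_arc M k = rolling_trace (hyperbola_param M) (of_real (\<sigma> * c))"
      by (simp add: nodoid_arc_def fun_eq_iff \<sigma>_def c_def)
    moreover have "of_real (b * (- \<sigma> * r t) / (2 * v t ^ 3)) * Complex (- b) (\<sigma> * c * sinh t)
        = of_real (\<sigma> * b * r t / (2 * v t ^ 3)) * Complex b (c * sinh t)"
      using False by (simp add: \<sigma>_def complex_eq_iff)
    ultimately show ?thesis
      using trace(2) by simp
  qed
qed

text \<open>Here \<open>v\<^sup>2 = r * (r + \<sigma>)\<close> takes the place of \<open>v\<^sup>2 = r * (1 - r)\<close>, which reverses the sign of the
  middle term of the first integral for both kinds of arcs: the normal with mean curvature 1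
  lies on the other side, relative to the direction of travel, than on an unduloid.\<close>

lemma focal_arc_hyperbola:
  assumes M: "M > 0"
  shows "focal_arc M (- 1) (nodoid_arc M k)"
    and "Im (nodoid_arc M k 0) = sqrt (1/4 + M) - (if even k then 1 else - 1) / 2"
proof -
  define b c and \<sigma> :: real where "b = sqrt M" and "c = sqrt (1/4 + M)" and "\<sigma> = (if even k then 1 else - 1)"
  define r v where "r = (\<lambda>t. c * cosh t - \<sigma> / 2)" and "v = (\<lambda>t. sqrt ((c * cosh t)\<^sup>2 - 1/4))"
  note arc = nodoid_arc_explicit(1,2)[OF M, of k, folded b_def c_def \<sigma>_def]
    nodoid_arc_explicit(3)[OF M, where k = k, folded b_def c_def \<sigma>_def]
    nodoid_arc_explicit(4,5)[OF M, folded b_def c_def]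
  have im: "Im (nodoid_arc M k t) = b * r t / v t" and r: "r t > 0" and v: "v t > 0"
    and v2: "(v t)\<^sup>2 = (c * cosh t)\<^sup>2 - 1/4" for t
    using arc by (simp_all add: r_def v_def)
  define h where "h = (\<lambda>t. b * r t / (2 * v t ^ 3))"
  have d: "(nodoid_arc M k has_vector_derivative of_real (\<sigma> * h t) * Complex b (c * sinh t)) (at t)" for t
    using arc(2) unfolding r_def v_def h_def by (simp add: mult.assoc)
  have b: "b > 0" "b\<^sup>2 = M" and c: "c > 0" "c\<^sup>2 = 1/4 + M" using M by (simp_all add: b_def c_def)
  have s: "\<bar>\<sigma>\<bar> = 1" "\<sigma>\<^sup>2 = 1" by (simp_all add: \<sigma>_def)
  have h: "h t > 0" for t using b r v by (simp add: h_def)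
  have norm: "norm (Complex b (c * sinh t)) = v t" for t
  proof -
    have "b\<^sup>2 + (c * sinh t)\<^sup>2 = (v t)\<^sup>2"
      unfolding v2 power_mult_distrib sinh_square_eq c(2) b(2) by (simp add: field_simps)
    then show ?thesis using v[of t] by (simp add: cmod_def)
  qed
  have eqn: "delaunay_equation M (- 1) (nodoid_arc M k t) (of_real (\<sigma> * h t) * Complex b (c * sinh t))" for t
  proof -
    have "(r t)\<^sup>2 - (v t)\<^sup>2 = - \<sigma> * r t"
      unfolding v2 r_def using s(2) by (simp add: field_simps power2_eq_square)
    then have "b\<^sup>2 * ((r t)\<^sup>2 - (v t)\<^sup>2) * (v t)\<^sup>2 * h t = b\<^sup>2 * (- \<sigma> * r t) * (v t)\<^sup>2 * h t" by simp
    moreover have "M = b\<^sup>2" using b by simp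
    ultimately show ?thesis
      unfolding delaunay_equation_def norm_mult norm im norm_of_real using v[of t] h[of t] s(1)
      by (simp add: abs_mult field_simps power2_eq_square)
  qed
  show "focal_arc M (- 1) (nodoid_arc M k)"
    unfolding focal_arc_def
  proof (intro exI conjI allI impI)
    show "Im (nodoid_arc M k t) > 0" for t using im b r v by simp
    show "\<exists>t\<in>{a<..<b}. Im (of_real (\<sigma> * h t) * Complex b' (c * sinh t)) \<noteq> 0" if "a < b" for a b b'
      using exists_sinh_nonzero[OF that] c(1) h s(1) by (auto simp: less_le)
  qed (rule d eqn)+
  have "sqrt (c\<^sup>2 - 1/4) = b" by (simp add: c(2) b_def)
  then show "Im (nodoid_arc M k 0) = sqrt (1/4 + M) - (if even k then 1 else - 1) / 2"
    using b(1) unfolding im by (simp add: r_def v_def c_def \<sigma>_def)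
qed

section \<open>Existence of the profile curves\<close>

lemma unduloid_profile_exists:
  assumes M: "M < 0" "-1/4 < M"
  shows "\<exists>\<delta>. unduloid_profile M \<delta>"
proof -
  define e where "e = sqrt (1/4 + M)"
  have e: "e\<^sup>2 = 1/4 + M" using M by (simp add: e_def)
  define b where "b = sqrt (- M)"
  have b: "b > 0" using M by (simp add: b_def)
  define r v where "r = (\<lambda>t. 1/2 - e * cos t)" and "v = (\<lambda>t. sqrt (1/4 - (e * cos t)\<^sup>2))"
  define \<alpha> where "\<alpha> = rolling_trace (ellipse_param M) (of_real e)"
  note trace = rolling_trace_ellipse[OF M(1) e, folded b_def]
  have r: "r t > 0" and v: "v t > 0" for t
    using trace unfolding r_def v_def by auto
  define h where "h = (\<lambda>t. b * r t / (2 * v t ^ 3))"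
  have d1: "(\<alpha> has_vector_derivative of_real (h t) * Complex b (e * sin t)) (at t)" for t
    using trace(2) unfolding \<alpha>_def r_def v_def h_def by auto
  define v' where "v' = (\<lambda>t. e\<^sup>2 * cos t * sin t / v t)"
  define h' where "h' = (\<lambda>t. (b * (e * sin t) * (2 * v t ^ 3) - b * r t * (2 * (3 * (v t)\<^sup>2 * v' t))) / (2 * v t ^ 3)\<^sup>2)"
  have dv: "(v has_real_derivative v' t) (at t)" for t
    unfolding v'_def v_def using v[of t] unfolding v_def
    by (auto intro!: derivative_eq_intros simp: field_simps power2_eq_square)
  have dr: "(r has_real_derivative e * sin t) (at t)" for t
    unfolding r_def by (auto intro!: derivative_eq_intros)
  have dh: "(h has_real_derivative h' t) (at t)" for t
    unfolding h_def h'_def using v[of t]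
    by (auto intro!: derivative_eq_intros dv dr simp: power2_eq_square)
  have d2: "((\<lambda>t. of_real (h t) * Complex b (e * sin t)) has_vector_derivative
      Complex (h' t * b) (h' t * (e * sin t) + h t * (e * cos t))) (at t)" for t
    unfolding has_vector_derivative_complex_iff by (auto intro!: derivative_eq_intros dh)
  have cont: "continuous_on UNIV v" "continuous_on UNIV r"
    unfolding v_def r_def by (intro continuous_intros)+
  have nz: "v t \<noteq> 0" for t using v[of t] by simp
  have c2: "continuous_on UNIV (\<lambda>t. Complex (h' t * b) (h' t * (e * sin t) + h t * (e * cos t)))"
    unfolding h'_def h_def v'_def by (intro continuous_intros cont) (auto simp: nz)
  have reg: "vector_derivative \<alpha> (at t) \<noteq> 0" for t
    using vector_derivative_at[OF d1] b r[of t] v[of t] by (auto simp: h_def complex_eq_iff)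
  have "C2_regular_curve \<alpha>"
    unfolding C2_regular_curve_def C2_on_def
    by (intro conjI exI ballI allI, rule d1, rule d2, rule c2, rule reg)
  moreover have "traverses \<alpha> UNIV \<alpha>"
    unfolding traverses_def C2_on_def
    by (intro exI[of _ id] conjI exI[of _ "\<lambda>_. 1"] exI[of _ "\<lambda>_. 0"])
       (auto simp: id_def intro!: derivative_eq_intros)
  moreover have "of_real e \<in> conic_foci M" by (simp add: conic_foci_def e_def)
  ultimately show ?thesis unfolding unduloid_profile_def \<alpha>_def by blast
qed

text \<open>The parameters of the arcs become infinite at the junctions, so a smooth parametrization of the
  whole nodoid has to come from elsewhere: the angle \<open>a\<close> between tangent and axis. The first
  integral \<open>y\<^sup>2 + y * cos a = M\<close> gives \<open>y = (q - cos a) / 2\<close> with \<open>q = sqrt ((cos a)\<^sup>2 + 4 * M)\<close>, and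
  \<open>y' = g * sin a\<close> with \<open>g = (1 - cos a / q) / 2\<close>, so \<open>g\<close> is the speed and \<open>g * cos a\<close> the axial
  velocity. The arcs meet where the tangent is perpendicular to the axis. On an arc the tangent
  direction is \<open>b + \<i> * c * sinh t\<close> up to sign, so the change of parameter is given by
  \<open>b * tan a = c * sinh t\<close>, and it is seen to be twice differentiable from the autonomous equation
  \<open>\<phi>' = h (\<phi>)\<close> that it solves.\<close>

lemma nodoid_profile_exists:
  assumes M: "M > 0"
  shows "\<exists>\<delta>. nodoid_profile M \<delta>"
proof -
  define b c where "b = sqrt M" and "c = sqrt (1/4 + M)"
  have b: "b > 0" "b\<^sup>2 = M" and c: "c > 0" "c\<^sup>2 = 1/4 + M" using M by (simp_all add: b_def c_def)
  define q where "q = (\<lambda>a. sqrt ((cos a)\<^sup>2 + 4 * M))"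
  have qpos: "(cos a)\<^sup>2 + 4 * M > 0" for a using M by (intro add_nonneg_pos) auto
  have q: "q a > 0" "(q a)\<^sup>2 = (cos a)\<^sup>2 + 4 * M" for a
    using qpos[of a] by (simp_all add: q_def)
  have q_gt: "cos a < q a" for a
    unfolding q_def using M by (intro real_less_rsqrt) simp
  define g where "g = (\<lambda>a. (1 - cos a / q a) / 2)"
  define g' where "g' = (\<lambda>a. (sin a + cos a * (- cos a * sin a / q a) / q a) / q a / 2)"
  have g_pos: "g a > 0" for a using q_gt[of a] q(1)[of a] by (simp add: g_def)
  have dq: "(q has_real_derivative - cos a * sin a / q a) (at a)" for a
    unfolding q_def using qpos[of a]
    by (auto intro!: derivative_eq_intros simp: field_simps)
  have nz: "q a \<noteq> 0" for a using q(1)[of a] by simp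
  have dg: "(g has_real_derivative g' a) (at a)" for a
    unfolding g_def g'_def using nz[of a]
    by (auto intro!: derivative_eq_intros dq simp: field_simps)
  have cq: "continuous_on UNIV q" unfolding q_def by (intro continuous_intros)
  have cg: "continuous_on UNIV g" unfolding g_def by (intro continuous_intros cq) (auto simp: nz)
  have cg': "continuous_on UNIV g'" unfolding g'_def by (intro continuous_intros cq) (auto simp: nz)
  have "\<exists>X. \<forall>a::real. - \<infinity> < ereal a \<longrightarrow> ereal a < \<infinity> \<longrightarrow> (X has_vector_derivative g a * cos a) (at a)"
    using cg by (intro einterval_antiderivative) (auto intro!: continuous_intros simp: continuous_on_eq_continuous_at)
  then obtain X where dX: "(X has_real_derivative g a * cos a) (at a)" for a
    by (auto simp: has_real_derivative_iff_has_vector_derivative)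
  define \<delta> where "\<delta> = (\<lambda>a. Complex (X a) ((q a - cos a) / 2))"
  define \<delta>' where "\<delta>' = (\<lambda>a. Complex (g a * cos a) (g a * sin a))"
  have "((\<lambda>a. (q a - cos a) / 2) has_real_derivative g a * sin a) (at a)" for a
  proof -
    have "((\<lambda>a. (q a - cos a) / 2) has_real_derivative (- cos a * sin a / q a + sin a) / 2) (at a)"
      using DERIV_cdivide[OF DERIV_diff[OF dq DERIV_cos], of 2 a] by simp
    moreover have "(- cos a * sin a / q a + sin a) / 2 = g a * sin a"
      using nz[of a] by (simp add: g_def field_simps)
    ultimately show ?thesis by simp
  qed
  then have d1: "(\<delta> has_vector_derivative \<delta>' a) (at a)" for a
    using dX by (simp add: \<delta>_def \<delta>'_def has_vector_derivative_complex_iff)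
  have d2: "(\<delta>' has_vector_derivative
      Complex (g' a * cos a - g a * sin a) (g' a * sin a + g a * cos a)) (at a)" for a
    unfolding \<delta>'_def has_vector_derivative_complex_iff
    by (auto intro!: derivative_eq_intros dg)
  have c2: "continuous_on UNIV (\<lambda>a. Complex (g' a * cos a - g a * sin a) (g' a * sin a + g a * cos a))"
    by (intro continuous_intros cg cg')
  have reg: "vector_derivative \<delta> (at a) \<noteq> 0" for a
  proof -
    have "cos a \<noteq> 0 \<or> sin a \<noteq> 0" by (metis cos_one_sin_zero sin_zero_abs_cos_one abs_zero zero_neq_one)
    then have "\<delta>' a \<noteq> 0" using g_pos[of a] by (simp add: \<delta>'_def complex_eq_iff)
    then show ?thesis using vector_derivative_at[OF d1] by simp
  qed
  have "C2_regular_curve \<delta>"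
    unfolding C2_regular_curve_def C2_on_def
    by (intro conjI exI ballI allI, rule d1, rule d2, rule c2, rule reg)
  define u where "u = (\<lambda>k::int. pi * k - pi / 2)"
  have "strict_mono u" by (auto simp: strict_mono_def u_def)
  moreover have "\<exists>k. u k \<le> x \<and> x < u (k + 1)" for x
  proof -
    define k where "k = \<lfloor>x / pi + 1/2\<rfloor>"
    have "of_int k \<le> x / pi + 1/2" "x / pi + 1/2 < of_int k + 1" by (auto simp: k_def)
    then have "u k \<le> x \<and> x < u (k + 1)" by (simp add: u_def field_simps)
    then show ?thesis ..
  qed
  moreover have "\<exists>\<tau>. traverses \<delta> {u k<..<u (k + 1)} (\<lambda>t. nodoid_arc M k t + of_real \<tau>)" for k
  proof -
    define S where "S = {u k<..<u (k + 1)}"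
    define \<sigma> :: real where "\<sigma> = (if even k then 1 else - 1)"
    have s: "\<sigma>\<^sup>2 = 1" by (simp add: \<sigma>_def)
    define r v where "r = (\<lambda>t. c * cosh t - \<sigma> / 2)" and "v = (\<lambda>t. sqrt ((c * cosh t)\<^sup>2 - 1/4))"
    note arc = nodoid_arc_explicit(1,2)[OF M, of k, folded b_def c_def \<sigma>_def]
      nodoid_arc_explicit(4,5)[OF M, folded b_def c_def]
    have im: "Im (nodoid_arc M k t) = b * r t / v t" and v: "v t > 0"
      and v2: "(v t)\<^sup>2 = (c * cosh t)\<^sup>2 - 1/4"
      and darc: "(nodoid_arc M k has_vector_derivative
      of_real (\<sigma> * b * r t / (2 * v t ^ 3)) * Complex b (c * sinh t)) (at t)" for t
      using arc by (simp_all add: r_def v_def)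
    define \<phi> where "\<phi> = (\<lambda>a. arsinh (b / c * tan a))"
    define h where "h = (\<lambda>t. (v t)\<^sup>2 / (b * c * cosh t))"
    define h' where "h' = (\<lambda>t. c / b * sinh t + sinh t / (4 * b * c * (cosh t)\<^sup>2))"
    have cosh_nz: "cosh t \<noteq> 0" for t :: real using cosh_real_pos[of t] by simp
    have h_eq: "h = (\<lambda>t. c / b * cosh t - 1 / (4 * b * c * cosh t))"
      unfolding h_def v2 using b(1) c(1) cosh_nz by (auto simp: field_simps power2_eq_square)
    have dh: "(h has_real_derivative h' t) (at t)" for t
      unfolding h_eq h'_def using b(1) c(1) cosh_nz[of t]
      by (auto intro!: derivative_eq_intros simp: field_simps power2_eq_square)
    have h_pos: "h t > 0" for t using v[of t] b c cosh_real_pos[of t] by (simp add: h_def)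
    have cos_sign: "\<sigma> * cos a > 0" if "a \<in> S" for a
    proof -
      have "cos (a - pi * k) > 0"
        using that by (intro cos_gt_zero_pi) (auto simp: S_def u_def algebra_simps)
      then show ?thesis by (auto simp: cos_diff \<sigma>_def split: if_splits)
    qed
    then have cos_nz: "cos a \<noteq> 0" if "a \<in> S" for a using that by fastforce
    have v_cos: "(v (\<phi> a))\<^sup>2 * (cos a)\<^sup>2 = b\<^sup>2" if "a \<in> S" for a
    proof -
      have "c * sinh (\<phi> a) * cos a = b * sin a"
        using c(1) cos_nz[OF that] by (simp add: \<phi>_def tan_def)
      then have "(c * sinh (\<phi> a) * cos a)\<^sup>2 = (b * sin a)\<^sup>2" by simp
      then show ?thesis
        unfolding v2 power_mult_distrib cosh_square_eq sin_squared_eq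
        using b(2) c(2) by algebra
    qed
    \<comment> \<open>The tangents are parallel by the choice of \<open>\<phi>\<close>; they point the same way because \<open>\<sigma>\<close> is the
      sign of \<open>cos a\<close> on \<open>S\<close>.\<close>
    have cos_v: "cos a = \<sigma> * b / v (\<phi> a)" if "a \<in> S" for a
    proof -
      have "(v (\<phi> a) * (\<sigma> * cos a))\<^sup>2 = b\<^sup>2"
        using v_cos[OF that] s by (simp add: power_mult_distrib)
      then have "v (\<phi> a) * (\<sigma> * cos a) = b"
        by (rule power2_eq_imp_eq) (use v[of "\<phi> a"] cos_sign[OF that] b(1) in \<open>auto simp: less_imp_le\<close>)
      then have "\<sigma> * b = v (\<phi> a) * cos a"
        using s by (auto simp: \<sigma>_def split: if_splits)
      then show ?thesis using v[of "\<phi> a"] by (simp add: field_simps)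
    qed
    have q_v: "q a = 2 * b * c * cosh (\<phi> a) / v (\<phi> a)" if "a \<in> S" for a
    proof (rule power2_eq_imp_eq)
      have "(2 * b * c * cosh (\<phi> a) / v (\<phi> a))\<^sup>2 = 4 * b\<^sup>2 * ((v (\<phi> a))\<^sup>2 + 1/4) / (v (\<phi> a))\<^sup>2"
      proof -
        have "(v (\<phi> a))\<^sup>2 + 1/4 = (c * cosh (\<phi> a))\<^sup>2" by (simp add: v2)
        then show ?thesis by (simp only: power_divide power_mult_distrib) simp
      qed
      also have "\<dots> = 4 * b\<^sup>2 + (\<sigma> * b / v (\<phi> a))\<^sup>2"
        using v[of "\<phi> a"] s by (simp add: field_simps power_mult_distrib power_divide)
      finally show "(q a)\<^sup>2 = (2 * b * c * cosh (\<phi> a) / v (\<phi> a))\<^sup>2"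
        unfolding q(2) cos_v[OF that, symmetric] b(2) by simp
    qed (use q(1) v b c in \<open>auto simp: less_imp_le\<close>)
    have d\<phi>: "(\<phi> has_real_derivative h (\<phi> a)) (at a)" if "a \<in> S" for a
    proof -
      have "cosh (\<phi> a) = sqrt ((b / c * tan a)\<^sup>2 + 1)"
        unfolding \<phi>_def by (simp add: cosh_arsinh_real)
      moreover have "h (\<phi> a) = b / c * inverse ((cos a)\<^sup>2) / cosh (\<phi> a)"
        using v_cos[OF that, symmetric] cos_nz[OF that] b(1) c(1) cosh_nz[of "\<phi> a"]
        by (simp add: h_def field_simps power2_eq_square)
      moreover have "(\<phi> has_real_derivative
          1 / sqrt ((b / c * tan a)\<^sup>2 + 1) * (b / c * inverse ((cos a)\<^sup>2))) (at a)"
        unfolding \<phi>_def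
        by (rule DERIV_chain2[OF arsinh_real_has_field_derivative DERIV_cmult[OF DERIV_tan]])
          (rule cos_nz[OF that])
      ultimately show ?thesis by (simp add: mult.commute)
    qed
    have "C2_on S \<phi>"
      unfolding C2_on_def has_real_derivative_iff_has_vector_derivative[symmetric]
    proof (intro exI conjI ballI)
      show "((\<lambda>a. h (\<phi> a)) has_real_derivative h' (\<phi> a) * h (\<phi> a)) (at a)" if "a \<in> S" for a
        by (rule DERIV_chain2[OF dh d\<phi>[OF that]])
      have c\<phi>: "continuous_on S \<phi>" and ch: "continuous_on UNIV h"
        using DERIV_isCont[OF d\<phi>] DERIV_isCont[OF dh] by (auto intro: continuous_at_imp_continuous_on)
      have ch': "continuous_on UNIV h'"
        unfolding h'_def by (intro continuous_intros) (use b(1) c(1) cosh_nz in auto)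
      show "continuous_on S (\<lambda>a. h' (\<phi> a) * h (\<phi> a))"
        by (rule continuous_on_mult[OF continuous_on_compose2[OF ch' c\<phi>] continuous_on_compose2[OF ch c\<phi>]]) auto
    qed (rule d\<phi>)
    moreover have "\<forall>a\<in>S. deriv \<phi> a > 0"
      using DERIV_imp_deriv[OF d\<phi>] h_pos by simp
    moreover have "\<phi> ` S = UNIV"
    proof -
      have "t \<in> \<phi> ` S" for t
      proof
        define a where "a = arctan (c / b * sinh t) + of_int k * pi"
        show "a \<in> S" using arctan_bounded[of "c / b * sinh t"]
          by (simp add: S_def u_def a_def algebra_simps)
        show "t = \<phi> a"
          using b(1) c(1) by (simp add: \<phi>_def a_def tan_arctan arsinh_sinh_real)
      qed
      then show ?thesis by auto
    qed
    \<comment> \<open>The heights agree by the first integral; the abscissas have the same derivative, and their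
      constant difference is the translation of the arc.\<close>
    moreover have "\<exists>\<tau>. \<forall>a\<in>S. X a - Re (nodoid_arc M k (\<phi> a)) = \<tau>"
    proof (rule has_field_derivative_zero_constant)
      show "convex S" by (simp add: S_def)
      fix a assume a: "a \<in> S"
      have "g a * cos a - \<sigma> * b * r (\<phi> a) / (2 * v (\<phi> a) ^ 3) * b * h (\<phi> a) = 0"
        unfolding g_def q_v[OF a] cos_v[OF a] h_def r_def using v[of "\<phi> a"] b(1) c(1) cosh_nz[of "\<phi> a"]
        by (simp add: field_simps power2_eq_square power3_eq_cube)
      moreover have "((\<lambda>t. Re (nodoid_arc M k t)) has_real_derivative
          \<sigma> * b * r (\<phi> a) / (2 * v (\<phi> a) ^ 3) * b) (at (\<phi> a))"
        using darc[of "\<phi> a"] by (simp add: has_vector_derivative_complex_iff)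
      note DERIV_diff[OF dX DERIV_chain2[OF this d\<phi>[OF a]]]
      ultimately have "((\<lambda>a. X a - Re (nodoid_arc M k (\<phi> a))) has_real_derivative 0) (at a)"
        by (simp only:)
      then show "((\<lambda>a. X a - Re (nodoid_arc M k (\<phi> a))) has_real_derivative 0) (at a within S)"
        by (rule has_field_derivative_at_within)
    qed
    then obtain \<tau> where \<tau>: "\<And>a. a \<in> S \<Longrightarrow> X a - Re (nodoid_arc M k (\<phi> a)) = \<tau>" by blast
    have "\<delta> a = nodoid_arc M k (\<phi> a) + of_real \<tau>" if "a \<in> S" for a
    proof (rule complex_eqI)
      show "Re (\<delta> a) = Re (nodoid_arc M k (\<phi> a) + of_real \<tau>)"
        using \<tau>[OF that] by (simp add: \<delta>_def)
      show "Im (\<delta> a) = Im (nodoid_arc M k (\<phi> a) + of_real \<tau>)"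
        using v[of "\<phi> a"] by (simp add: \<delta>_def im q_v[OF that] cos_v[OF that] r_def field_simps)
    qed
    ultimately show ?thesis
      unfolding traverses_def S_def[symmetric] by blast
  qed
  then obtain \<tau> where "\<And>k. traverses \<delta> {u k<..<u (k + 1)} (\<lambda>t. nodoid_arc M k t + of_real (\<tau> k))"
    by metis
  ultimately show ?thesis
    unfolding nodoid_profile_def using \<open>C2_regular_curve \<delta>\<close> by blast
qed

section \<open>Curvature of Delaunay surfaces\<close>

theorem theorem1p9:
  fixes M :: real
  assumes "M \<noteq> 0" and "-1/4 < M"
  shows "(\<exists>X. delaunay_surface M X) \<and>
    (\<forall>X. delaunay_surface M X \<longrightarrow>
      (\<exists>N. unit_normal_field X N \<and>
           (\<forall>p. mean_curvature X N p = 1) \<and>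
           (\<exists>Kmax Kmin.
              Kmax \<in> range (gauss_curvature X N) \<and> (\<forall>p. gauss_curvature X N p \<le> Kmax) \<and>
              Kmin \<in> range (gauss_curvature X N) \<and> (\<forall>p. Kmin \<le> gauss_curvature X N p) \<and>
              Kmax / Kmin = - ((1 - sqrt (1 + 4 * M)) / (1 + sqrt (1 + 4 * M)))\<^sup>2)))"
proof (intro conjI allI impI)
  have "\<exists>\<delta>. delaunay_profile M \<delta>"
    using unduloid_profile_exists[of M] nodoid_profile_exists[of M] assms
    by (auto simp: delaunay_profile_def linorder_neq_iff)
  then show "\<exists>X. delaunay_surface M X" by (auto simp: delaunay_surface_def)
next
  fix X assume "delaunay_surface M X"
  then obtain \<delta> where profile: "delaunay_profile M \<delta>" and X: "X = surface_of_revolution \<delta>"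
    by (auto simp: delaunay_surface_def)
  \<comment> \<open>The sign of the unit normal for which the mean curvature is 1.\<close>
  define \<eta> :: real where "\<eta> = (if M < 0 then 1 else - 1)"
  define c where "c = sqrt (1/4 + M)"
  have c: "c > 0" "c\<^sup>2 = 1/4 + M" using assms by (simp_all add: c_def)
  have c_half: "M < 0 \<longleftrightarrow> c < 1/2"
  proof -
    have "c < 1/2 \<longleftrightarrow> c\<^sup>2 < (1/2)\<^sup>2" using c(1) by (auto intro: power_strict_mono dest: power2_less_imp_less)
    then have "c < 1/2 \<longleftrightarrow> c\<^sup>2 < 1/4" by (simp add: power2_eq_square)
    then show ?thesis using c(2) by auto
  qed
  have "C2_regular_curve \<delta>"
    using profile by (auto simp: delaunay_profile_def unduloid_profile_def nodoid_profile_def split: if_splits)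
  then obtain \<delta>' \<delta>'' where d1: "\<And>t. (\<delta> has_vector_derivative \<delta>' t) (at t)"
    and d2: "\<And>t. (\<delta>' has_vector_derivative \<delta>'' t) (at t)" and c2: "continuous_on UNIV \<delta>''"
    and reg: "\<And>t. vector_derivative \<delta> (at t) \<noteq> 0"
    unfolding C2_regular_curve_def C2_on_def by auto
  have reg: "\<delta>' t \<noteq> 0" for t using reg[of t] vector_derivative_at[OF d1] by simp
  have "(\<forall>t. Im (\<delta> t) > 0 \<and> delaunay_equation M \<eta> (\<delta> t) (\<delta>' t)) \<and>
      (\<forall>a b. a < b \<longrightarrow> (\<exists>t\<in>{a<..<b}. Im (\<delta>' t) \<noteq> 0)) \<and>
      (\<exists>t. Im (\<delta> t) = c + 1/2) \<and> (\<exists>t. Im (\<delta> t) = \<bar>c - 1/2\<bar>)"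
  proof (cases "M < 0")
    case True
    with profile obtain F where F: "F \<in> conic_foci M"
      and "traverses \<delta> UNIV (rolling_trace (ellipse_param M) F)"
      by (auto simp: delaunay_profile_def unduloid_profile_def)
    then have trav: "traverses \<delta> UNIV (\<lambda>t. rolling_trace (ellipse_param M) F t + of_real 0)" by simp
    obtain e where e: "F = of_real e" "e = c \<or> e = - c"
      using F unfolding conic_foci_def c_def[symmetric] by (metis insertE of_real_minus singletonD)
    have "e\<^sup>2 = 1/4 + M" "e \<noteq> 0" using e(2) c by auto
    note arc = focal_arc_ellipse[OF True this, folded e(1)]
    have eta: "\<eta> = 1" using True by (simp add: \<eta>_def)
    have "\<exists>t. Im (\<delta> t) = 1/2 - e" "\<exists>t. Im (\<delta> t) = 1/2 + e"
      using traverses_focal_arc(4)[OF arc(1) trav open_UNIV d1, of 0]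
        traverses_focal_arc(4)[OF arc(1) trav open_UNIV d1, of pi] unfolding arc by auto
    moreover have "\<bar>c - 1/2\<bar> = 1/2 - c" using c_half True by simp
    ultimately show ?thesis
      using traverses_focal_arc(1-3)[OF arc(1) trav open_UNIV d1] e(2) unfolding eta
      by (auto simp: add.commute)
  next
    case False
    then have M: "M > 0" using assms by simp
    have eta: "\<eta> = - 1" using False by (simp add: \<eta>_def)
    from False profile have "nodoid_profile M \<delta>" by (simp add: delaunay_profile_def)
    then obtain u \<tau> where
      cover: "\<forall>x. \<exists>k. u k \<le> x \<and> x < u (k + 1)" and
      "\<forall>k. traverses \<delta> {u k<..<u (k + 1)} (\<lambda>t. nodoid_arc M k t + of_real (\<tau> k))"
      unfolding nodoid_profile_def by blast
    then have trav: "traverses \<delta> {u k<..<u (k + 1)} (\<lambda>t. nodoid_arc M k t + of_real (\<tau> k))" for k by blast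
    note arc = traverses_focal_arc[OF focal_arc_hyperbola(1)[OF M] trav open_greaterThanLessThan d1]
    have d': "continuous_on UNIV \<delta>'"
      using d2 by (meson has_vector_derivative_continuous continuous_at_imp_continuous_on)
    have "Im (\<delta> x) > 0 \<and> delaunay_equation M \<eta> (\<delta> x) (\<delta>' x)" for x
    proof -
      from cover obtain k where k: "u k \<le> x" "x < u (k + 1)" by auto
      have "Im (\<delta> t) > 0 \<and> delaunay_equation M \<eta> (\<delta> t) (\<delta>' t)" if "x < t" "t < u (k + 1)" for t
        using arc(1,2)[of t k] that k by (auto simp: eta)
      from delaunay_equation_extends[OF d1 d' reg assms(1) k(2) this] show ?thesis by simp
    qed
    moreover have "\<exists>t\<in>{a<..<b}. Im (\<delta>' t) \<noteq> 0" if "a < b" for a b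
    proof -
      from cover obtain k where k: "u k \<le> a" "a < u (k + 1)" by auto
      have "\<exists>t\<in>{a<..<min b (u (k + 1))}. Im (\<delta>' t) \<noteq> 0"
        by (rule arc(3)[of _ _ k]) (use that k in auto)
      then show ?thesis by auto
    qed
    moreover have "\<exists>t. Im (\<delta> t) = c + 1/2" "\<exists>t. Im (\<delta> t) = c - 1/2"
      using arc(4)[of 1 0] arc(4)[of 0 0] by (simp_all add: focal_arc_hyperbola(2)[OF M] c_def)
    moreover have "\<bar>c - 1/2\<bar> = c - 1/2" using c_half False by simp
    ultimately show ?thesis by auto
  qed
  then obtain tmax tmin where
    pos: "\<And>t. Im (\<delta> t) > 0" and eqn: "\<And>t. delaunay_equation M \<eta> (\<delta> t) (\<delta>' t)"
    and dense: "\<And>a b. a < b \<Longrightarrow> \<exists>t\<in>{a<..<b}. Im (\<delta>' t) \<noteq> 0"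
    and ext: "Im (\<delta> tmax) = c + 1/2" "Im (\<delta> tmin) = \<bar>c - 1/2\<bar>"
    by blast
  have "\<bar>\<eta>\<bar> = 1" by (simp add: \<eta>_def)
  from delaunay_equation_imp_curvature_ratio[OF assms this d1 d2 c2 reg pos eqn dense ext[unfolded c_def]]
  show "\<exists>N. unit_normal_field X N \<and>
           (\<forall>p. mean_curvature X N p = 1) \<and>
           (\<exists>Kmax Kmin.
              Kmax \<in> range (gauss_curvature X N) \<and> (\<forall>p. gauss_curvature X N p \<le> Kmax) \<and>
              Kmin \<in> range (gauss_curvature X N) \<and> (\<forall>p. Kmin \<le> gauss_curvature X N p) \<and>
              Kmax / Kmin = - ((1 - sqrt (1 + 4 * M)) / (1 + sqrt (1 + 4 * M)))\<^sup>2)"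
    unfolding X .
qed

end
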